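(* Let $\boldsymbol{X}_t\in\mathbb{R}^d$ be a stationary community-$\alpha$ GNAR process with interactions, of known order $([p_c],\{[s_k(c)]\},[C],\{\mathcal{I}_c\})$ (see context), from which a realisation of length $T$ is observed. Let $\boldsymbol{y}=\mathbf{R}\boldsymbol{\theta_0}+\boldsymbol{u}$ be the associated linear model, with $\boldsymbol{\theta_0}\in\mathbb{R}^q$ the true parameter vector, viewed (after conditioning) as a fixed-design linear model, i.e. $\mathbf{R}=[\mathbf{R}_1|\dots|\mathbf{R}_C]$ is treated as a fixed matrix and $\boldsymbol{y}-\mathbf{R}\boldsymbol{\theta_0}=\boldsymbol{u}$. Let $\hat{\boldsymbol{\theta}}=(\mathbf{R}^T\mathbf{R})^{-1}\mathbf{R}^T\boldsymbol{y}$. Assume: (A.1) for every $c\in[C]$ there is $\tau_c>0$ such that $\lambda_{\min}(\mathbf{R}_c^T\mathbf{R}_c)\ge\{\tau_c|K_c|(T-p_c)\}^{1/2}$; (A.2) there is $\Gamma>0$ such that $\max_{j\in[q]}\|[\mathbf{R}]_{\cdot j}\|_2\le n^{-1/2}\Gamma$, where $n:=\min_{c\in[C]}\{|K_c|(T-p_c)\}$. Define $q_c:=p_c+(1+|\mathcal{I}_c|)\sum_{k=1}^{p_c}s_k(c)$, $q_{[C]}:=\max_{c\in[C]}q_c$, $p:=\max_{c\in[C]}p_c$, $\mathcal{K}_{[C]}:=\min_{c\in[C]}|K_c|$ and $\tau:=\min_{c\in[C]}\tau_c$. Then $$\|\hat{\boldsymbol{\theta}}-\boldsymbol{\theta_0}\|_2\le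 2\{\tau\mathcal{K}_{[C]}(T-p)\}^{-1/2}\,(Cq_{[C]})^{1/2}\,\|\mathbf{R}^T\boldsymbol{u}\|_\infty .$$ Further, assume in addition: (A.3) the residuals are independent sub-Gaussian white noise: for each $i\in\{1,\dots,d\}$ there is $\sigma_i^2>0$ such that $E\{\exp(zu_{i,t})\}\le\exp(z^2\sigma_i^2/2)$ for all $z\in\mathbb{R}$, and the $u_{i,t}$ are uncorrelated at all times $t=p+1,\dots,T$ for all $i$. Then for any $\delta>0$, $$\|\hat{\boldsymbol{\theta}}-\boldsymbol{\theta_0}\|_2\le 2(Cq_{[C]})^{1/2}\sigma_{\boldsymbol{u}}\Gamma\sqrt{2}\left[\left\{\log\Big(\sum_{c=1}^C q_c\Big)\{\tau\mathcal{K}_{[C]}(T-p)\}^{-1}\right\}^{1/2}+\delta\right]$$ holds with probability at least $$1-2\exp\left[-\delta^2\{\tau\mathcal{K}_{[C]}(T-p)\}\right],$$ where $\sigma_{\boldsymbol{u}}^2=\max_{i\in\{1,\dots,d\}}\sigma_i^2$.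
   Context: Network. $\mathcal{G}=(\mathcal{K},\mathcal{E})$ is a static undirected graph without self-loops on nodes $\mathcal{K}=\{1,\dots,d\}$; $\mathbf{S}_r\in\{0,1\}^{d\times d}$ has $[\mathbf{S}_r]_{ij}=1$ iff the shortest path between $i$ and $j$ has length $r$ ($r\ge1$). $\mathbf{W}_t\in\mathbb{R}^{d\times d}$ is a given matrix of weights $w_{ij}(t)\in[0,1]$ with zero diagonal. $\odot$ is the entrywise product, $[m]=\{1,\dots,m\}$. The communities $K_1,\dots,K_C$ are disjoint nonempty sets partitioning $\mathcal{K}$; $\boldsymbol{\xi}_c\in\{0,1\}^d$ is the indicator vector of $K_c$. Community regressors. $\boldsymbol{X}_t^c:=\boldsymbol{\xi}_c\odot\boldsymbol{X}_t$; $\boldsymbol{Z}_t^{r,c}:=(\mathbf{W}_{t,c}\odot\mathbf{S}_r)\boldsymbol{X}_t^c$ where $[\mathbf{W}_{t,c}]_{ij}=w_{ij}(t)\mathbb{I}(i\in K_c\text{ and }j\in K_c)$; $\boldsymbol{Z}_t^{r,c:\tilde c}:=\boldsymbol{\xi}_c\odot(\mathbf{W}_t\odot\mathbf{S}_r)\boldsymbol{X}_t^{\tilde c}$. The interaction set $\mathcal{I}_c\subseteq[C]\setminus\{c\}$ lists the communities that affect $K_c$ (no symmetry is required). Model. The community-$\alpha$ GNAR process with interactions of order $([p_c],\{[s_k(c)]\},[C],\{\mathcal{I}_c\})$ is $$\boldsymbol{X}_t=\sum_{c=1}^C\sum_{k=1}^{p_c}\Big\{\alpha_{k,c}\boldsymbol{X}_{t-k}^c+\sum_{r=1}^{s_k(c)}\Big(\beta_{k,r,c}\boldsymbol{Z}_{t-k}^{r,c}+\sum_{\tilde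 c\in\mathcal{I}_c}\gamma_{k,r,c:\tilde c}\boldsymbol{Z}_{t-k}^{r,c:\tilde c}\Big)\Big\}+\boldsymbol{u}_t,$$ with real coefficients, maximum lag $p_c\ge1$ and maximum $r$-stage depth $s_k(c)$ at lag $k$ for community $K_c$, and zero-mean white noise $\boldsymbol{u}_t=(u_{1,t},\dots,u_{d,t})$. Linear model. With $p=\max_c p_c$, $\boldsymbol{y}:=(\boldsymbol{X}_{p+1},\dots,\boldsymbol{X}_T)$ and $\boldsymbol{u}:=(\boldsymbol{u}_{p+1},\dots,\boldsymbol{u}_T)$ are stacked vectors in $\mathbb{R}^{d(T-p)}$. For each $c$, $\mathbf{R}_{k,c}$ is obtained by stacking by rows, over $t=p+1,\dots,T$, the blocks with columns $\boldsymbol{X}_{t-k}^c$, $\boldsymbol{Z}_{t-k}^{r,c}$ ($1\le r\le s_k(c)$) and $\boldsymbol{Z}_{t-k}^{r,c:\tilde c}$ ($1\le r\le s_k(c)$, $\tilde c\in\mathcal{I}_c$); $\mathbf{R}_c=[\mathbf{R}_{1,c}|\dots|\mathbf{R}_{p_c,c}]$, which has $q_c$ columns; $\mathbf{R}=[\mathbf{R}_1|\dots|\mathbf{R}_C]\in\mathbb{R}^{d(T-p)\times q}$, $q=\sum_c q_c$. The vector $\boldsymbol{\theta}=(\boldsymbol{\theta}_1,\dots,\boldsymbol{\theta}_C)$ stacks the coefficients $(\alpha,\beta,\gamma)$ of each community in the corresponding order, so that the model reads $\boldsymbol{y}=\mathbf{R}\boldsymbol{\theta}+\boldsymbol{u}$.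 Since the communities are disjoint, $\mathbf{R}_c$ and $\mathbf{R}_{c'}$ have their nonzero entries in different rows when $c\ne c'$. $[\mathbf{R}]_{\cdot j}$ is the $j$th column of $\mathbf{R}$, $\lambda_{\min}$ the smallest eigenvalue. *)

theory Defs
  imports
    "HOL-Probability.Probability"
    "Jordan_Normal_Form.Gauss_Jordan_Elimination"
    "Jordan_Normal_Form.Char_Poly"
begin

unbundle no vec_syntax
hide_const (open) Finite_Cartesian_Product.vec Finite_Cartesian_Product.mat
hide_type (open) Finite_Cartesian_Product.vec
no_notation inner (infix \<open>\<bullet>\<close> 70)

text \<open>
  Vectors and matrices are those of Jordan_Normal_Form, with indices starting at 0; in particular
  the nodes are 0, ..., d - 1.  Communities, lags, stages and observation times keep their indices
  starting at 1.
\<close>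

section \<open>Vectors and matrices\<close>

definition l2_norm :: "real vec \<Rightarrow> real" where
  "l2_norm v = sqrt (v \<bullet> v)"

definition linf_norm :: "real vec \<Rightarrow> real" where
  "linf_norm v = Max ((\<lambda>i. \<bar>v $ i\<bar>) ` {..<dim_vec v})"

text \<open>The minimum ranges over the real eigenvalues only; lambda_min is used for symmetric matrices, which
  have no others.\<close>

definition lambda_min :: "real mat \<Rightarrow> real" where
  "lambda_min A = Min {k. eigenvalue A k}"

definition vec_odot :: "real vec \<Rightarrow> real vec \<Rightarrow> real vec" (infixl \<open>\<odot>\<^sub>v\<close> 75) where
  "v \<odot>\<^sub>v w = vec (dim_vec w) (\<lambda>i. v $ i * w $ i)"

definition mat_odot :: "real mat \<Rightarrow> real mat \<Rightarrow> real mat" (infixl \<open>\<odot>\<^sub>m\<close> 75) where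
  "A \<odot>\<^sub>m B = mat (dim_row B) (dim_col B) (\<lambda>(i, j). A $$ (i, j) * B $$ (i, j))"

text \<open>The inverse is the one computed by mat_inverse; the value is unspecified if the Gram matrix is
  singular.\<close>

definition ols :: "real mat \<Rightarrow> real vec \<Rightarrow> real vec" where
  "ols R y = (the (mat_inverse (transpose_mat R * R)) * transpose_mat R) *\<^sub>v y"

section \<open>Network, communities and order of the model\<close>

record gnar =
  n_nodes :: nat
  edges :: "nat set set"
  weights :: "int \<Rightarrow> real mat"
  n_comms :: nat
  comm :: "nat \<Rightarrow> nat set"
  lag :: "nat \<Rightarrow> nat"
  depth :: "nat \<Rightarrow> nat \<Rightarrow> nat"  \<comment> \<open>depth G k c is the maximum stage of community c at lag k\<close>
  interact :: "nat \<Rightarrow> nat set"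

definition wf_gnar :: "gnar \<Rightarrow> bool" where
  "wf_gnar G \<longleftrightarrow>
     0 < n_nodes G \<and>
     (\<forall>e\<in>edges G. e \<subseteq> {..<n_nodes G} \<and> card e = 2) \<and>
     (\<forall>t. weights G t \<in> carrier_mat (n_nodes G) (n_nodes G) \<and>
        (\<forall>i<n_nodes G. \<forall>j<n_nodes G. weights G t $$ (i, j) \<in> {0..1}) \<and>
        (\<forall>i<n_nodes G. weights G t $$ (i, i) = 0)) \<and>
     (\<forall>c\<in>{1..n_comms G}. comm G c \<noteq> {}) \<and>
     disjoint_family_on (comm G) {1..n_comms G} \<and>
     (\<Union>c\<in>{1..n_comms G}. comm G c) = {..<n_nodes G} \<and>
     (\<forall>c\<in>{1..n_comms G}. 1 \<le> lag G c) \<and>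
     (\<forall>c\<in>{1..n_comms G}. interact G c \<subseteq> {1..n_comms G} - {c})"

text \<open>A path is given by its list of vertices, so its length is one less than that of the list.\<close>

definition is_path :: "gnar \<Rightarrow> nat \<Rightarrow> nat list \<Rightarrow> nat \<Rightarrow> bool" where
  "is_path G i vs j \<longleftrightarrow>
     vs \<noteq> [] \<and> set vs \<subseteq> {..<n_nodes G} \<and> distinct vs \<and> hd vs = i \<and> last vs = j \<and>
     successively (\<lambda>v w. {v, w} \<in> edges G) vs"

definition shortest_path_length :: "gnar \<Rightarrow> nat \<Rightarrow> nat \<Rightarrow> nat \<Rightarrow> bool" where
  "shortest_path_length G i j r \<longleftrightarrow>
     (\<exists>vs. is_path G i vs j \<and> length vs - 1 = r) \<and>
     (\<forall>vs. is_path G i vs j \<longrightarrow> r \<le> length vs - 1)"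

definition stage_mat :: "gnar \<Rightarrow> nat \<Rightarrow> real mat" where
  "stage_mat G r = mat (n_nodes G) (n_nodes G)
     (\<lambda>(i, j). if shortest_path_length G i j r then 1 else 0)"

definition max_lag :: "gnar \<Rightarrow> nat" where
  "max_lag G = Max (lag G ` {1..n_comms G})"

definition min_comm_size :: "gnar \<Rightarrow> nat" where
  "min_comm_size G = Min ((\<lambda>c. card (comm G c)) ` {1..n_comms G})"

definition n_params :: "gnar \<Rightarrow> nat \<Rightarrow> nat" where
  "n_params G c = lag G c + (1 + card (interact G c)) * (\<Sum>k=1..lag G c. depth G k c)"

definition max_n_params :: "gnar \<Rightarrow> nat" where
  "max_n_params G = Max (n_params G ` {1..n_comms G})"

section \<open>Community regressors\<close>

text \<open>Throughout, x is a trajectory of the process, indexed by time.\<close>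

definition comm_ind :: "gnar \<Rightarrow> nat \<Rightarrow> real vec" where
  "comm_ind G c = vec (n_nodes G) (\<lambda>i. if i \<in> comm G c then 1 else 0)"

definition comm_weights :: "gnar \<Rightarrow> int \<Rightarrow> nat \<Rightarrow> real mat" where
  "comm_weights G t c = mat (n_nodes G) (n_nodes G)
     (\<lambda>(i, j). if i \<in> comm G c \<and> j \<in> comm G c then weights G t $$ (i, j) else 0)"

definition own_reg :: "gnar \<Rightarrow> (int \<Rightarrow> real vec) \<Rightarrow> nat \<Rightarrow> int \<Rightarrow> real vec" where
  "own_reg G x c t = comm_ind G c \<odot>\<^sub>v x t"

definition nbr_reg :: "gnar \<Rightarrow> (int \<Rightarrow> real vec) \<Rightarrow> nat \<Rightarrow> nat \<Rightarrow> int \<Rightarrow> real vec" where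
  "nbr_reg G x r c t = (comm_weights G t c \<odot>\<^sub>m stage_mat G r) *\<^sub>v own_reg G x c t"

definition inter_reg :: "gnar \<Rightarrow> (int \<Rightarrow> real vec) \<Rightarrow> nat \<Rightarrow> nat \<Rightarrow> nat \<Rightarrow> int \<Rightarrow> real vec" where
  "inter_reg G x r c c' t =
     comm_ind G c \<odot>\<^sub>v ((weights G t \<odot>\<^sub>m stage_mat G r) *\<^sub>v own_reg G x c' t)"

section \<open>The stochastic process\<close>

definition covar :: "'w measure \<Rightarrow> ('w \<Rightarrow> real) \<Rightarrow> ('w \<Rightarrow> real) \<Rightarrow> real" where
  "covar M f g =
     (\<integral>\<omega>. (f \<omega> - (\<integral>\<omega>'. f \<omega>' \<partial>M)) * (g \<omega> - (\<integral>\<omega>'. g \<omega>' \<partial>M)) \<partial>M)"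

definition second_order :: "'w measure \<Rightarrow> nat \<Rightarrow> (int \<Rightarrow> 'w \<Rightarrow> real vec) \<Rightarrow> bool" where
  "second_order M d X \<longleftrightarrow>
     (\<forall>t. \<forall>\<omega>\<in>space M. X t \<omega> \<in> carrier_vec d) \<and>
     (\<forall>t. \<forall>i<d. (\<lambda>\<omega>. X t \<omega> $ i) \<in> borel_measurable M \<and>
        integrable M (\<lambda>\<omega>. (X t \<omega> $ i)\<^sup>2))"

definition stationary :: "'w measure \<Rightarrow> nat \<Rightarrow> (int \<Rightarrow> 'w \<Rightarrow> real vec) \<Rightarrow> bool" where
  "stationary M d X \<longleftrightarrow>
     second_order M d X \<and>
     (\<forall>s t. \<forall>i<d. (\<integral>\<omega>. X s \<omega> $ i \<partial>M) = (\<integral>\<omega>. X t \<omega> $ i \<partial>M)) \<and>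
     (\<forall>s t h. \<forall>i<d. \<forall>j<d.
        covar M (\<lambda>\<omega>. X (s + h) \<omega> $ i) (\<lambda>\<omega>. X s \<omega> $ j) =
        covar M (\<lambda>\<omega>. X (t + h) \<omega> $ i) (\<lambda>\<omega>. X t \<omega> $ j))"

text \<open>Multivariate white noise: the components may be correlated at equal times.\<close>

definition white_noise :: "'w measure \<Rightarrow> nat \<Rightarrow> (int \<Rightarrow> 'w \<Rightarrow> real vec) \<Rightarrow> bool" where
  "white_noise M d u \<longleftrightarrow>
     stationary M d u \<and>
     (\<forall>t. \<forall>i<d. (\<integral>\<omega>. u t \<omega> $ i \<partial>M) = 0) \<and>
     (\<forall>s t. s \<noteq> t \<longrightarrow> (\<forall>i<d. \<forall>j<d. covar M (\<lambda>\<omega>. u s \<omega> $ i) (\<lambda>\<omega>. u t \<omega> $ j) = 0))"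

definition gnar_process ::
  "'w measure \<Rightarrow> gnar \<Rightarrow> (nat \<Rightarrow> nat \<Rightarrow> real) \<Rightarrow> (nat \<Rightarrow> nat \<Rightarrow> nat \<Rightarrow> real) \<Rightarrow>
   (nat \<Rightarrow> nat \<Rightarrow> nat \<Rightarrow> nat \<Rightarrow> real) \<Rightarrow> (int \<Rightarrow> 'w \<Rightarrow> real vec) \<Rightarrow> (int \<Rightarrow> 'w \<Rightarrow> real vec) \<Rightarrow> bool"
where
  "gnar_process M G \<alpha> \<beta> \<gamma> X u \<longleftrightarrow>
     white_noise M (n_nodes G) u \<and>
     (\<forall>t. \<forall>i<n_nodes G. (\<lambda>\<omega>. X t \<omega> $ i) \<in> borel_measurable M) \<and>
     (\<forall>t. \<forall>\<omega>\<in>space M. X t \<omega> \<in> carrier_vec (n_nodes G) \<and>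
       (\<forall>i<n_nodes G. X t \<omega> $ i =
          (\<Sum>c=1..n_comms G. \<Sum>k=1..lag G c.
             \<alpha> k c * own_reg G (\<lambda>s. X s \<omega>) c (t - int k) $ i +
             (\<Sum>r=1..depth G k c.
                \<beta> k r c * nbr_reg G (\<lambda>s. X s \<omega>) r c (t - int k) $ i +
                (\<Sum>c'\<in>interact G c.
                   \<gamma> k r c c' * inter_reg G (\<lambda>s. X s \<omega>) r c c' (t - int k) $ i)))
          + u t \<omega> $ i))"

text \<open>The sub-Gaussian condition bounds a moment generating function, so integrability has to be
  required explicitly: the Bochner integral of a non-integrable function is 0.\<close>

definition subgaussian_noise ::
  "'w measure \<Rightarrow> nat \<Rightarrow> nat set \<Rightarrow> (nat \<Rightarrow> real) \<Rightarrow> (int \<Rightarrow> 'w \<Rightarrow> real vec) \<Rightarrow> bool" where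
  "subgaussian_noise M d ts sigma2 u \<longleftrightarrow>
     (\<forall>i<d. sigma2 i > 0 \<and>
        (\<forall>t\<in>ts. \<forall>z.
           integrable M (\<lambda>\<omega>. exp (z * u (int t) \<omega> $ i)) \<and>
           (\<integral>\<omega>. exp (z * u (int t) \<omega> $ i) \<partial>M) \<le> exp (z\<^sup>2 * sigma2 i / 2))) \<and>
     prob_space.indep_vars M (\<lambda>_. borel) (\<lambda>(t, i) \<omega>. u (int t) \<omega> $ i) (ts \<times> {..<d}) \<and>
     (\<forall>s\<in>ts. \<forall>t\<in>ts. \<forall>i<d. \<forall>j<d. (s, i) \<noteq> (t, j) \<longrightarrow>
        covar M (\<lambda>\<omega>. u (int s) \<omega> $ i) (\<lambda>\<omega>. u (int t) \<omega> $ j) = 0)"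

section \<open>The associated linear model\<close>

text \<open>Labels of the columns of the design matrix.\<close>

datatype regressor =
    Own nat nat              \<comment> \<open>lag, community\<close>
  | Nbr nat nat nat          \<comment> \<open>lag, stage, community\<close>
  | Cross nat nat nat nat    \<comment> \<open>lag, stage, community, affecting community\<close>

fun reg_value :: "gnar \<Rightarrow> (int \<Rightarrow> real vec) \<Rightarrow> int \<Rightarrow> regressor \<Rightarrow> real vec" where
  "reg_value G x t (Own k c) = own_reg G x c (t - int k)"
| "reg_value G x t (Nbr k r c) = nbr_reg G x r c (t - int k)"
| "reg_value G x t (Cross k r c c') = inter_reg G x r c c' (t - int k)"

fun reg_coeff ::
  "(nat \<Rightarrow> nat \<Rightarrow> real) \<Rightarrow> (nat \<Rightarrow> nat \<Rightarrow> nat \<Rightarrow> real) \<Rightarrow> (nat \<Rightarrow> nat \<Rightarrow> nat \<Rightarrow> nat \<Rightarrow> real) \<Rightarrow>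
   regressor \<Rightarrow> real" where
  "reg_coeff \<alpha> \<beta> \<gamma> (Own k c) = \<alpha> k c"
| "reg_coeff \<alpha> \<beta> \<gamma> (Nbr k r c) = \<beta> k r c"
| "reg_coeff \<alpha> \<beta> \<gamma> (Cross k r c c') = \<gamma> k r c c'"

definition lag_regs :: "gnar \<Rightarrow> nat \<Rightarrow> nat \<Rightarrow> regressor list" where
  "lag_regs G c k =
     Own k c # map (\<lambda>r. Nbr k r c) [1..<Suc (depth G k c)] @
     concat (map (\<lambda>r. map (\<lambda>c'. Cross k r c c') (sorted_list_of_set (interact G c)))
       [1..<Suc (depth G k c)])"

definition comm_regs :: "gnar \<Rightarrow> nat \<Rightarrow> regressor list" where
  "comm_regs G c = concat (map (lag_regs G c) [1..<Suc (lag G c)])"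

definition all_regs :: "gnar \<Rightarrow> regressor list" where
  "all_regs G = concat (map (comm_regs G) [1..<Suc (n_comms G)])"

text \<open>Row m of a stacked object belongs to node m mod d at time p + 1 + m div d.\<close>

definition stack :: "gnar \<Rightarrow> nat \<Rightarrow> (int \<Rightarrow> real vec) \<Rightarrow> real vec" where
  "stack G T x = vec (n_nodes G * (T - max_lag G))
     (\<lambda>m. x (int (max_lag G + 1 + m div n_nodes G)) $ (m mod n_nodes G))"

definition reg_mat :: "gnar \<Rightarrow> nat \<Rightarrow> (int \<Rightarrow> real vec) \<Rightarrow> regressor list \<Rightarrow> real mat" where
  "reg_mat G T x regs = mat_of_cols (n_nodes G * (T - max_lag G))
     (map (\<lambda>\<rho>. stack G T (\<lambda>t. reg_value G x t \<rho>)) regs)"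

definition comm_design :: "gnar \<Rightarrow> nat \<Rightarrow> (int \<Rightarrow> real vec) \<Rightarrow> nat \<Rightarrow> real mat" where
  "comm_design G T x c = reg_mat G T x (comm_regs G c)"

definition design :: "gnar \<Rightarrow> nat \<Rightarrow> (int \<Rightarrow> real vec) \<Rightarrow> real mat" where
  "design G T x = reg_mat G T x (all_regs G)"

definition param_vec ::
  "gnar \<Rightarrow> (nat \<Rightarrow> nat \<Rightarrow> real) \<Rightarrow> (nat \<Rightarrow> nat \<Rightarrow> nat \<Rightarrow> real) \<Rightarrow> (nat \<Rightarrow> nat \<Rightarrow> nat \<Rightarrow> nat \<Rightarrow> real) \<Rightarrow>
   real vec" where
  "param_vec G \<alpha> \<beta> \<gamma> = vec_of_list (map (reg_coeff \<alpha> \<beta> \<gamma>) (all_regs G))"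

lemma length_comm_regs:
  assumes "wf_gnar G" "c \<in> {1..n_comms G}"
  shows "length (comm_regs G c) = n_params G c"
proof -
  have "length (lag_regs G c k) = 1 + (1 + card (interact G c)) * depth G k c" for k
    by (simp add: lag_regs_def length_concat comp_def sum_list_triv algebra_simps)
  then have "length (comm_regs G c) = (\<Sum>k\<leftarrow>[1..<Suc (lag G c)]. 1 + (1 + card (interact G c)) * depth G k c)"
    by (simp add: comm_regs_def length_concat comp_def del: upt_Suc)
  also have "\<dots> = (\<Sum>k=1..lag G c. 1 + (1 + card (interact G c)) * depth G k c)"
    by (simp add: interv_sum_list_conv_sum_set_nat atLeastLessThanSuc_atLeastAtMost del: upt_Suc)
  also have "\<dots> = n_params G c"
    unfolding sum.distrib by (simp add: n_params_def sum_distrib_left)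
  finally show ?thesis .
qed

text \<open>The model equation in stacked form.  Evaluated at a single outcome, it identifies the
  observations with the response of the linear model whose design comes from the same trajectory.\<close>

lemma gnar_linear_model:
  assumes G: "wf_gnar G" and X: "gnar_process M G \<alpha> \<beta> \<gamma> X u" and \<omega>: "\<omega> \<in> space M"
  shows "stack G T (\<lambda>t. X t \<omega>) =
           design G T (\<lambda>t. X t \<omega>) *\<^sub>v param_vec G \<alpha> \<beta> \<gamma> + stack G T (\<lambda>t. u t \<omega>)"
proof (rule eq_vecI)
  let ?x = "\<lambda>t. X t \<omega>"
  let ?N = "n_nodes G * (T - max_lag G)"
  fix m assume "m < dim_vec (design G T ?x *\<^sub>v param_vec G \<alpha> \<beta> \<gamma> + stack G T (\<lambda>t. u t \<omega>))"
  then have m: "m < ?N" by (simp add: stack_def)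
  define i where "i = m mod n_nodes G"
  define t where "t = int (max_lag G + 1 + m div n_nodes G)"
  have i: "i < n_nodes G" using G by (simp add: i_def wf_gnar_def)
  define f where "f \<rho> = reg_coeff \<alpha> \<beta> \<gamma> \<rho> * reg_value G ?x t \<rho> $ i" for \<rho>
  have entry: "(design G T ?x *\<^sub>v param_vec G \<alpha> \<beta> \<gamma>) $ m = (\<Sum>\<rho>\<leftarrow>all_regs G. f \<rho>)"
  proof -
    have "(design G T ?x *\<^sub>v param_vec G \<alpha> \<beta> \<gamma>) $ m
            = (\<Sum>j = 0..<length (all_regs G). f (all_regs G ! j))"
      using m
      by (auto simp: design_def reg_mat_def param_vec_def scalar_prod_def mat_of_cols_def stack_def
          vec_of_list_index f_def i_def t_def mult.commute intro!: sum.cong)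
    then show ?thesis by (simp add: sum_list_sum_nth atLeast0LessThan)
  qed
  have fin: "finite (interact G c)" if "c \<in> {1..n_comms G}" for c
    using G that unfolding wf_gnar_def by (meson finite_Diff finite_atLeastAtMost finite_subset)
  have sl: "sum_list (map g [1..<Suc n]) = sum g {1..n}" for g :: "nat \<Rightarrow> real" and n
    by (simp add: interv_sum_list_conv_sum_set_nat atLeastLessThanSuc_atLeastAtMost del: upt_Suc)
  have cc: "sum_list (map f (concat (map g xs))) = (\<Sum>x\<leftarrow>xs. sum_list (map f (g x)))"
    for g :: "nat \<Rightarrow> regressor list" and xs
    by (induction xs) auto
  have lagr: "(\<Sum>\<rho>\<leftarrow>lag_regs G c k. f \<rho>) = f (Own k c) +
      (\<Sum>r=1..depth G k c. f (Nbr k r c) + (\<Sum>c'\<in>interact G c. f (Cross k r c c')))"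
    if "c \<in> {1..n_comms G}" for c k
    using fin[OF that]
    by (simp add: lag_regs_def cc comp_def sl sum.distrib
        sum_list_distinct_conv_sum_set atLeastLessThanSuc_atLeastAtMost
        del: upt_Suc sum.op_ivl_Suc)
  have "(\<Sum>\<rho>\<leftarrow>all_regs G. f \<rho>) =
      (\<Sum>c=1..n_comms G. \<Sum>k=1..lag G c. f (Own k c) +
        (\<Sum>r=1..depth G k c. f (Nbr k r c) + (\<Sum>c'\<in>interact G c. f (Cross k r c c'))))"
    by (simp add: all_regs_def comm_regs_def cc sl[unfolded One_nat_def] lagr del: upt_Suc)
  also have "\<dots> + u t \<omega> $ i = X t \<omega> $ i"
    using X \<omega> i unfolding gnar_process_def by (simp add: f_def)
  finally have "stack G T ?x $ m =
      (design G T ?x *\<^sub>v param_vec G \<alpha> \<beta> \<gamma>) $ m + stack G T (\<lambda>t. u t \<omega>) $ m"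
    using m by (simp only: entry) (simp add: stack_def i_def t_def)
  then show "stack G T ?x $ m =
      (design G T ?x *\<^sub>v param_vec G \<alpha> \<beta> \<gamma> + stack G T (\<lambda>t. u t \<omega>)) $ m"
    using m by (simp add: stack_def)
qed (simp add: stack_def)

end

theory Submission
  imports Defs
begin

text \<open>
  Since the blocks of the design belong to disjoint sets of rows, the eigenvalue conditions on the
  blocks give \<open>\<parallel>R v\<parallel>\<^sup>2 \<ge> sqrt s \<parallel>v\<parallel>\<^sup>2\<close> for \<open>s = \<tau> K (T - p)\<close>.  With \<open>w = \<theta>hat - \<theta>\<^sub>0\<close> we have
  \<open>R\<^sup>T R w = R\<^sup>T u\<close>, hence \<open>sqrt s \<parallel>w\<parallel>\<^sup>2 \<le> w \<bullet> R\<^sup>T u\<close>, and Cauchy-Schwarz bounds \<open>\<parallel>w\<parallel>\<close> by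
  \<open>\<parallel>R\<^sup>T u\<parallel> / sqrt s\<close>.  The entries of \<open>R\<^sup>T u\<close> are weighted sums of independent sub-Gaussian variables,
  so a Chernoff bound for each column and a union bound control the supremum norm.
\<close>

section \<open>Quadratic forms and the least eigenvalue\<close>

lemma scalar_prod_self: "v \<bullet> v = (\<Sum>i<dim_vec v. (v $ i)\<^sup>2)" for v :: "real vec"
  by (simp add: scalar_prod_def power2_eq_square atLeast0LessThan)

lemma scalar_prod_self_nonneg: "0 \<le> v \<bullet> v" for v :: "real vec"
  by (simp add: scalar_prod_self sum_nonneg)

lemma abs_prod_le_scalar_prod_self:
  fixes v :: "real vec"
  assumes "i < dim_vec v" "j < dim_vec v"
  shows "\<bar>v $ i\<bar> * \<bar>v $ j\<bar> \<le> v \<bullet> v"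
proof -
  have sq: "(v $ k)\<^sup>2 \<le> v \<bullet> v" if "k < dim_vec v" for k
    unfolding scalar_prod_self using that by (intro member_le_sum) auto
  have "2 * (\<bar>v $ i\<bar> * \<bar>v $ j\<bar>) \<le> (v $ i)\<^sup>2 + (v $ j)\<^sup>2"
    using sum_squares_bound[of "\<bar>v $ i\<bar>" "\<bar>v $ j\<bar>"] by simp
  with sq[OF assms(1)] sq[OF assms(2)] show ?thesis by linarith
qed

text \<open>The form is a sum of terms \<open>A $$ (i, j) * (x $ i * x $ j)\<close>, and each
  product of two entries is at most \<open>x \<bullet> x\<close> in absolute value. Adding 1 to the
  sum of the absolute entries keeps the constant positive even for the zero matrix, so that one can
  divide by it.\<close>

lemma quadratic_form_bounded:
  assumes A: "(A :: real mat) \<in> carrier_mat n n"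
  obtains K where "K > 0" "\<And>x. x \<in> carrier_vec n \<Longrightarrow> \<bar>x \<bullet> (A *\<^sub>v x)\<bar> \<le> K * (x \<bullet> x)"
proof
  let ?K = "\<Sum>i<n. \<Sum>j<n. \<bar>A $$ (i, j)\<bar>"
  have K0: "0 \<le> ?K" by (simp add: sum_nonneg)
  then show "1 + ?K > 0" by linarith
  fix x :: "real vec" assume x: "x \<in> carrier_vec n"
  have "x \<bullet> (A *\<^sub>v x) = (\<Sum>i<n. \<Sum>j<n. A $$ (i, j) * (x $ i * x $ j))"
    using A x by (auto simp: scalar_prod_def sum_distrib_left atLeast0LessThan intro!: sum.cong)
  also have "\<bar>\<dots>\<bar> \<le> (\<Sum>i<n. \<Sum>j<n. \<bar>A $$ (i, j)\<bar> * (\<bar>x $ i\<bar> * \<bar>x $ j\<bar>))"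
    by (intro order_trans[OF sum_abs] sum_mono) (simp add: abs_mult)
  also have "\<dots> \<le> (\<Sum>i<n. \<Sum>j<n. \<bar>A $$ (i, j)\<bar> * (x \<bullet> x))"
    using x by (intro sum_mono mult_left_mono abs_prod_le_scalar_prod_self) auto
  also have "\<dots> = ?K * (x \<bullet> x)" by (simp add: sum_distrib_right)
  also have "\<dots> \<le> (1 + ?K) * (x \<bullet> x)"
    using scalar_prod_self_nonneg[of x] by (intro mult_right_mono) auto
  finally show "\<bar>x \<bullet> (A *\<^sub>v x)\<bar> \<le> (1 + ?K) * (x \<bullet> x)" .
qed

text \<open>Testing non-negativity at \<open>x - s \<cdot> B\<inverse> x\<close> turns a bound on the form of \<open>B\<inverse>\<close> into
  strict positivity of the form of \<open>B\<close>.\<close>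

lemma nonneg_form_invertible_imp_coercive:
  assumes B: "(B :: real mat) \<in> carrier_mat n n" and sym: "transpose_mat B = B"
    and C: "C \<in> carrier_mat n n" "B * C = 1\<^sub>m n"
    and nonneg: "\<And>x. x \<in> carrier_vec n \<Longrightarrow> 0 \<le> x \<bullet> (B *\<^sub>v x)"
  obtains \<epsilon> where "\<epsilon> > 0" "\<And>x. x \<in> carrier_vec n \<Longrightarrow> \<epsilon> * (x \<bullet> x) \<le> x \<bullet> (B *\<^sub>v x)"
proof -
  obtain K where K: "K > 0" "\<And>x. x \<in> carrier_vec n \<Longrightarrow> \<bar>x \<bullet> (C *\<^sub>v x)\<bar> \<le> K * (x \<bullet> x)"
    using quadratic_form_bounded[OF C(1)] by blast
  \<comment> \<open>With \<open>y = C x\<close> and \<open>z = x - s y\<close>, the value of the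
    form at \<open>z\<close> is
    \<open>x \<bullet> B x - 2 s (x \<bullet> x) + s^2 (x \<bullet> y)\<close>. Since
    \<open>x \<bullet> y\<close> is at most \<open>K (x \<bullet> x)\<close>, the gain is at least
    \<open>(2 s - s^2 K) (x \<bullet> x)\<close>, which is largest at
    \<open>s = 1 / K\<close>.\<close>
  have "1 / K * (x \<bullet> x) \<le> x \<bullet> (B *\<^sub>v x)" if x: "x \<in> carrier_vec n" for x
  proof -
    define y where "y = C *\<^sub>v x"
    have y: "y \<in> carrier_vec n" using C x by (simp add: y_def)
    have By: "B *\<^sub>v y = x"
      using assoc_mult_mat_vec[OF B C(1) x] C x by (simp add: y_def)
    have yBx: "y \<bullet> (B *\<^sub>v x) = x \<bullet> x"
      using transpose_vec_mult_scalar[OF B x y] sym By by simp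
    let ?s = "1 / K"
    let ?z = "x - ?s \<cdot>\<^sub>v y"
    have Bz: "B *\<^sub>v ?z = B *\<^sub>v x - ?s \<cdot>\<^sub>v x"
      using B x y By by (simp add: mult_minus_distrib_mat_vec[of _ n n] mult_mat_vec[of _ n n])
    have Bx: "B *\<^sub>v x \<in> carrier_vec n" using B x by simp
    have "0 \<le> ?z \<bullet> (B *\<^sub>v ?z)" using nonneg x y by simp
    also have "\<dots> = x \<bullet> (B *\<^sub>v x) - 2 * ?s * (x \<bullet> x) + ?s\<^sup>2 * (x \<bullet> y)"
      unfolding Bz using x y Bx yBx comm_scalar_prod[OF y x]
      by (simp add: minus_scalar_prod_distrib[of _ n] scalar_prod_minus_distrib[of _ n]
          power2_eq_square algebra_simps)
    finally have "2 * ?s * (x \<bullet> x) - ?s\<^sup>2 * (x \<bullet> y) \<le> x \<bullet> (B *\<^sub>v x)" by simp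
    moreover have "?s\<^sup>2 * (x \<bullet> y) \<le> ?s\<^sup>2 * (K * (x \<bullet> x))"
      using K(2)[OF x] by (intro mult_left_mono) (auto simp: y_def)
    moreover have "?s\<^sup>2 * (K * (x \<bullet> x)) = ?s * (x \<bullet> x)"
      using K(1) by (simp add: power2_eq_square)
    ultimately show ?thesis by linarith
  qed
  then show thesis using that[of "1 / K"] K(1) by simp
qed

text \<open>Eigenvalues are roots of the monic, hence nonzero, characteristic polynomial. Finiteness
  gives the \<open>Min\<close> in \<open>lambda_min\<close> its meaning.\<close>

lemma finite_eigenvalues:
  assumes A: "(A :: 'a :: field mat) \<in> carrier_mat n n"
  shows "finite {k. eigenvalue A k}"
proof -
  have "char_poly A \<noteq> 0" using degree_monic_char_poly[OF A] by auto
  then show ?thesis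
    using poly_roots_finite by (simp add: eigenvalue_root_char_poly[OF A])
qed

text \<open>The largest \<open>\<mu>\<close> with \<open>\<mu> (x \<bullet> x) \<le> x \<bullet> A x\<close> for all \<open>x\<close> is an eigenvalue: if \<open>A - \<mu>\<close> were
  invertible, it would be coercive and \<open>\<mu>\<close> could be increased.\<close>

lemma lambda_min_le_quadratic_form:
  assumes A: "A \<in> carrier_mat n n" and sym: "transpose_mat A = A" and x: "x \<in> carrier_vec n"
  shows "lambda_min A * (x \<bullet> x) \<le> x \<bullet> (A *\<^sub>v x)"
proof (cases "n = 0")
  \<comment> \<open>In dimension 0 there are no eigenvalues and \<open>lambda_min\<close> is the
    unspecified minimum of the empty set, but both sides are 0.\<close>
  case True
  then show ?thesis using A x by (simp add: scalar_prod_def)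
next
  case False
  define S where "S = {\<mu>. \<forall>x\<in>carrier_vec n. \<mu> * (x \<bullet> x) \<le> x \<bullet> (A *\<^sub>v x)}"
  obtain K where K: "K > 0" "\<And>x. x \<in> carrier_vec n \<Longrightarrow> \<bar>x \<bullet> (A *\<^sub>v x)\<bar> \<le> K * (x \<bullet> x)"
    using quadratic_form_bounded[OF A] by blast
  have "- K \<in> S" using K(2) by (fastforce simp: S_def abs_le_iff)
  then have ne: "S \<noteq> {}" by blast
  \<comment> \<open>Positive dimension provides a unit vector; testing with it bounds
    \<open>S\<close> from above, so the supremum is finite.\<close>
  have e: "unit_vec n 0 \<bullet> unit_vec n 0 = (1::real)" using False by simp
  have ub: "\<mu> \<le> K" if "\<mu> \<in> S" for \<mu>
  proof -
    have "\<mu> * 1 \<le> unit_vec n 0 \<bullet> (A *\<^sub>v unit_vec n 0)"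
      using that unfolding S_def e[symmetric] by (blast intro: unit_vec_carrier)
    also have "\<dots> \<le> K" using K(2)[OF unit_vec_carrier, of 0] unfolding e by linarith
    finally show ?thesis by simp
  qed
  then have bdd: "bdd_above S" by (rule bdd_aboveI)
  define \<mu> where "\<mu> = Sup S"
  have \<mu>S: "\<mu> * (x \<bullet> x) \<le> x \<bullet> (A *\<^sub>v x)" if x: "x \<in> carrier_vec n" for x
  proof (cases "x \<bullet> x = 0")
    \<comment> \<open>Here \<open>K * (x \<bullet> x)\<close> vanishes, and the bound by it forces
      the form to vanish as well.\<close>
    case True
    then show ?thesis using K(2)[OF x] by simp
  next
    case False
    then have pos: "x \<bullet> x > 0" using scalar_prod_self_nonneg[of x] by simp
    have "\<mu> \<le> x \<bullet> (A *\<^sub>v x) / (x \<bullet> x)"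
      unfolding \<mu>_def using ne x pos by (intro cSup_least) (auto simp: S_def field_simps)
    then show ?thesis using pos by (simp add: field_simps)
  qed
  define B where "B = char_matrix A \<mu>"
  have B: "B \<in> carrier_mat n n" using A by (simp add: B_def)
  have Bsym: "transpose_mat B = B"
  proof -
    have "A $$ (j, i) = A $$ (i, j)" if "i < n" "j < n" for i j
      using arg_cong[OF sym, of "\<lambda>M. M $$ (i, j)"] A that by simp
    then show ?thesis using A by (intro eq_matI) (auto simp: B_def char_matrix_def)
  qed
  have Bx: "x \<bullet> (B *\<^sub>v x) = x \<bullet> (A *\<^sub>v x) - \<mu> * (x \<bullet> x)" if x: "x \<in> carrier_vec n" for x
  proof -
    have "((-\<mu>) \<cdot>\<^sub>m 1\<^sub>m n) *\<^sub>v x = (-\<mu>) \<cdot>\<^sub>v x"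
      using x by (intro eq_vecI) (auto simp: row_smult)
    then show ?thesis
      using A x by (simp add: B_def char_matrix_def add_mult_distrib_mat_vec[of _ n n]
          scalar_prod_add_distrib[of _ n])
  qed
  have "eigenvalue A \<mu>"
  proof (rule ccontr)
    assume "\<not> eigenvalue A \<mu>"
    then have "det B \<noteq> 0" by (simp add: eigenvalue_det[OF A] B_def)
    then have "B \<in> Units (ring_mat TYPE(real) n ())" by (rule det_non_zero_imp_unit[OF B])
    then obtain C where "C \<in> carrier_mat n n" "B * C = 1\<^sub>m n"
      by (auto simp: Units_def ring_mat_simps)
    with B Bsym obtain \<epsilon> where \<epsilon>: "\<epsilon> > 0"
      "\<And>x. x \<in> carrier_vec n \<Longrightarrow> \<epsilon> * (x \<bullet> x) \<le> x \<bullet> (B *\<^sub>v x)"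
      by (rule nonneg_form_invertible_imp_coercive) (use \<mu>S Bx in auto)
    then have "\<mu> + \<epsilon> \<in> S" using Bx by (fastforce simp: S_def algebra_simps)
    then have "\<mu> + \<epsilon> \<le> \<mu>" unfolding \<mu>_def by (rule cSup_upper[OF _ bdd])
    with \<epsilon>(1) show False by simp
  qed
  then have "lambda_min A \<le> \<mu>"
    unfolding lambda_min_def by (intro Min_le finite_eigenvalues[OF A]) simp
  then have "lambda_min A * (x \<bullet> x) \<le> \<mu> * (x \<bullet> x)"
    using scalar_prod_self_nonneg by (intro mult_right_mono) auto
  with \<mu>S[OF x] show ?thesis by linarith
qed

text \<open>The quadratic form of a Gram matrix is the squared norm of \<open>A x\<close>. This is
  how (A.1) is applied to each block.\<close>

lemma lambda_min_gram:
  assumes A: "A \<in> carrier_mat N n" and x: "x \<in> carrier_vec n"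
  shows "lambda_min (transpose_mat A * A) * (x \<bullet> x) \<le> (A *\<^sub>v x) \<bullet> (A *\<^sub>v x)"
proof -
  have "lambda_min (transpose_mat A * A) * (x \<bullet> x) \<le> x \<bullet> ((transpose_mat A * A) *\<^sub>v x)"
    using A x
    by (intro lambda_min_le_quadratic_form[where n = n]) (auto simp: transpose_mult[of _ n N _ n])
  also have "\<dots> = (A *\<^sub>v x) \<bullet> (A *\<^sub>v x)"
    using A x transpose_vec_mult_scalar[OF A x, of "A *\<^sub>v x"]
      comm_scalar_prod[of x n "transpose_mat A *\<^sub>v (A *\<^sub>v x)"]
    by (simp add: assoc_mult_mat_vec[of _ n N _ n])
  finally show ?thesis .
qed

section \<open>Norms and least squares\<close>

lemma l2_norm_nonneg: "0 \<le> l2_norm v"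
  by (simp add: l2_norm_def scalar_prod_self_nonneg)

lemma l2_norm_sq: "(l2_norm v)\<^sup>2 = v \<bullet> v"
  by (simp add: l2_norm_def scalar_prod_self_nonneg)

lemma scalar_prod_le_l2_norm:
  assumes "v \<in> carrier_vec n" "w \<in> carrier_vec n"
  shows "v \<bullet> w \<le> l2_norm v * l2_norm w"
proof (rule power2_le_imp_le)
  have "v \<bullet> w = (\<Sum>i<n. v $ i * w $ i)"
    using assms by (simp add: scalar_prod_def atLeast0LessThan)
  then show "(v \<bullet> w)\<^sup>2 \<le> (l2_norm v * l2_norm w)\<^sup>2"
    using assms Cauchy_Schwarz_ineq_sum[of "\<lambda>i. v $ i" "\<lambda>i. w $ i" "{..<n}"]
    by (simp add: power_mult_distrib l2_norm_sq scalar_prod_self)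
qed (simp add: l2_norm_nonneg)

lemma l2_norm_le_linf_norm: "l2_norm v \<le> sqrt (real (dim_vec v)) * linf_norm v"
proof (cases "dim_vec v = 0")
  \<comment> \<open>The supremum norm of an empty vector is an unspecified \<open>Max\<close>; the
    factor \<open>sqrt 0\<close> removes it.\<close>
  case True
  then show ?thesis by (simp add: l2_norm_def scalar_prod_def)
next
  case False
  have le: "\<bar>v $ i\<bar> \<le> linf_norm v" if "i < dim_vec v" for i
    unfolding linf_norm_def using that by (intro Max_ge) auto
  with False have nonneg: "0 \<le> linf_norm v" by (meson abs_ge_zero order_trans not_gr_zero)
  have "v \<bullet> v \<le> (\<Sum>i<dim_vec v. (linf_norm v)\<^sup>2)"
    unfolding scalar_prod_self using le by (intro sum_mono) (auto intro: abs_le_square_iff[THEN iffD1] simp: nonneg)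
  then have "l2_norm v \<le> sqrt (real (dim_vec v) * (linf_norm v)\<^sup>2)"
    by (simp add: l2_norm_def)
  then show ?thesis using nonneg by (simp add: real_sqrt_mult)
qed

section \<open>Least squares for a design bounded below\<close>

context
  fixes R :: "real mat" and N q :: nat and \<kappa> :: real
  assumes R: "R \<in> carrier_mat N q" and \<kappa>: "\<kappa> > 0"
    and coercive: "\<And>x. x \<in> carrier_vec q \<Longrightarrow> \<kappa> * (x \<bullet> x) \<le> (R *\<^sub>v x) \<bullet> (R *\<^sub>v x)"
begin

text \<open>A vector in the kernel of the Gram matrix is mapped to 0 by \<open>R\<close>, so
  coercivity makes it 0. Hence \<open>mat_inverse\<close> returns a genuine inverse and
  \<open>ols\<close> is not an unspecified value.\<close>

lemma gram_inverse:
  defines "G \<equiv> transpose_mat R * R"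
  obtains W where "mat_inverse G = Some W" "W \<in> carrier_mat q q" "G * W = 1\<^sub>m q" "W * G = 1\<^sub>m q"
proof -
  have G: "G \<in> carrier_mat q q" using R by (simp add: G_def)
  have "det G \<noteq> 0"
  proof
    assume "det G = 0"
    then obtain v where v: "v \<in> carrier_vec q" "v \<noteq> 0\<^sub>v q" "G *\<^sub>v v = 0\<^sub>v q"
      using det_0_iff_vec_prod_zero[OF G] by auto
    have "(R *\<^sub>v v) \<bullet> (R *\<^sub>v v) = (G *\<^sub>v v) \<bullet> v"
      using R v(1) transpose_vec_mult_scalar[OF R v(1), of "R *\<^sub>v v"]
      by (simp add: G_def assoc_mult_mat_vec[of _ q N _ q])
    also have "\<dots> = 0" using v by simp
    finally have "\<kappa> * (v \<bullet> v) \<le> 0" using coercive[OF v(1)] by simp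
    with \<kappa> have "v \<bullet> v = 0"
      using scalar_prod_self_nonneg[of v] by (simp add: mult_le_0_iff)
    then have "\<forall>i<dim_vec v. v $ i = 0"
      by (simp add: scalar_prod_self sum_nonneg_eq_0_iff)
    then have "v = 0\<^sub>v q" using v(1) by auto
    with v(2) show False by simp
  qed
  then have "G \<in> Units (ring_mat TYPE(real) q ())" by (rule det_non_zero_imp_unit[OF G])
  then obtain W where W: "mat_inverse G = Some W"
    using mat_inverse(1)[OF G, of "()"] by (cases "mat_inverse G") auto
  with mat_inverse(2)[OF G W] that show thesis by blast
qed

text \<open>The estimator is linear and reproduces every \<open>R *\<^sub>v \<theta>\<close>
  exactly, so the error depends on the noise alone.\<close>

lemma ols_error:
  assumes \<theta>: "\<theta> \<in> carrier_vec q" and u: "u \<in> carrier_vec N"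
  shows "ols R (R *\<^sub>v \<theta> + u) - \<theta> = ols R u"
proof -
  define G where "G = transpose_mat R * R"
  obtain W where W: "mat_inverse G = Some W" "W \<in> carrier_mat q q" "G * W = 1\<^sub>m q" "W * G = 1\<^sub>m q"
    using gram_inverse unfolding G_def by blast
  define H where "H = W * transpose_mat R"
  have H: "H \<in> carrier_mat q N" using R W(2) by (simp add: H_def)
  have HR: "H * R = 1\<^sub>m q"
    using R W(2,4) by (simp add: H_def G_def assoc_mult_mat[of _ q q _ N _ q])
  have ols: "ols R v = H *\<^sub>v v" for v
    using W(1) by (simp add: ols_def H_def G_def)
  have "H *\<^sub>v (R *\<^sub>v \<theta> + u) = \<theta> + H *\<^sub>v u"
    using H R \<theta> u HR
    by (simp add: mult_add_distrib_mat_vec[of _ q N] assoc_mult_mat_vec[of _ q N _ q, symmetric])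
  then show ?thesis
    using \<theta> H u unfolding ols by (intro eq_vecI) auto
qed

lemma l2_norm_ols:
  assumes u: "u \<in> carrier_vec N"
  shows "\<kappa> * l2_norm (ols R u) \<le> l2_norm (transpose_mat R *\<^sub>v u)"
proof -
  define G where "G = transpose_mat R * R"
  obtain W where W: "mat_inverse G = Some W" "W \<in> carrier_mat q q" "G * W = 1\<^sub>m q" "W * G = 1\<^sub>m q"
    using gram_inverse unfolding G_def by blast
  have G: "G \<in> carrier_mat q q" using R by (simp add: G_def)
  define w where "w = ols R u"
  define v where "v = transpose_mat R *\<^sub>v u"
  have v: "v \<in> carrier_vec q" using R u by (simp add: v_def)
  have w_eq: "w = W *\<^sub>v v"
    using W R u by (simp add: w_def v_def ols_def G_def assoc_mult_mat_vec[of _ q q _ N])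
  have w: "w \<in> carrier_vec q" using W(2) v by (simp add: w_eq)
  have Gw: "G *\<^sub>v w = v"
    using assoc_mult_mat_vec[OF G W(2) v] W(3) v by (simp add: w_eq)
  have "\<kappa> * (w \<bullet> w) \<le> (R *\<^sub>v w) \<bullet> (R *\<^sub>v w)" by (rule coercive[OF w])
  also have "\<dots> = (G *\<^sub>v w) \<bullet> w"
    using R w transpose_vec_mult_scalar[OF R w, of "R *\<^sub>v w"]
    by (simp add: G_def assoc_mult_mat_vec[of _ q N _ q])
  also have "\<dots> \<le> l2_norm v * l2_norm w"
    unfolding Gw by (rule scalar_prod_le_l2_norm[OF v w])
  finally have *: "(\<kappa> * l2_norm w) * l2_norm w \<le> l2_norm v * l2_norm w"
    by (simp add: l2_norm_sq[symmetric] power2_eq_square)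
  \<comment> \<open>One factor \<open>l2_norm w\<close> is to be cancelled, so the case where it is
    zero is split off.\<close>
  show ?thesis
  proof (cases "l2_norm w = 0")
    case True
    then show ?thesis by (simp add: w_def[symmetric] l2_norm_nonneg)
  next
    case False
    then have "l2_norm w > 0" using l2_norm_nonneg[of w] by simp
    with * show ?thesis by (simp add: w_def v_def)
  qed
qed

end

section \<open>The design matrix\<close>

text \<open>The community whose rows a column can occupy: for \<open>Cross\<close> it is the
  affected community \<open>c\<close>, not the affecting community \<open>c'\<close> whose values
  enter.\<close>

fun reg_comm :: "regressor \<Rightarrow> nat" where
  "reg_comm (Own k c) = c"
| "reg_comm (Nbr k r c) = c"
| "reg_comm (Cross k r c c') = c"

text \<open>The mask differs by kind: the indicator acts on the observation for \<open>Own\<close>,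
  the rows of \<open>comm_weights\<close> vanish for \<open>Nbr\<close>, and the outer indicator
  cuts off \<open>Cross\<close>.\<close>

lemma reg_value_outside_comm:
  assumes x: "\<And>t. x t \<in> carrier_vec (n_nodes G)" and i: "i < n_nodes G" "i \<notin> comm G (reg_comm \<rho>)"
  shows "reg_value G x t \<rho> $ i = 0"
proof (cases \<rho>)
  case (Own k c)
  then show ?thesis
    using i x[of "t - int k"] by (simp add: own_reg_def vec_odot_def comm_ind_def)
next
  case (Nbr k r c)
  let ?A = "comm_weights G (t - int k) c \<odot>\<^sub>m stage_mat G r" and ?v = "own_reg G x c (t - int k)"
  have A: "?A \<in> carrier_mat (n_nodes G) (n_nodes G)"
    by (simp add: mat_odot_def stage_mat_def)
  have "row ?A i = 0\<^sub>v (n_nodes G)"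
    using i Nbr by (intro eq_vecI) (auto simp: mat_odot_def comm_weights_def stage_mat_def)
  moreover have "?v \<in> carrier_vec (n_nodes G)"
    using x[of "t - int k"] by (simp add: own_reg_def vec_odot_def)
  ultimately have "(?A *\<^sub>v ?v) $ i = 0" using A i(1) by simp
  then show ?thesis by (simp add: Nbr nbr_reg_def)
next
  case (Cross k r c c')
  then show ?thesis
    using i by (simp add: inter_reg_def vec_odot_def mat_odot_def comm_ind_def stage_mat_def)
qed

lemma reg_comm_lag_regs: "\<rho> \<in> set (lag_regs G c k) \<Longrightarrow> reg_comm \<rho> = c"
  by (auto simp: lag_regs_def)

lemma reg_comm_comm_regs: "\<rho> \<in> set (comm_regs G c) \<Longrightarrow> reg_comm \<rho> = c"
  unfolding comm_regs_def by (auto dest: reg_comm_lag_regs)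

lemma reg_mat_carrier: "reg_mat G T x regs \<in> carrier_mat (n_nodes G * (T - max_lag G)) (length regs)"
  unfolding reg_mat_def using mat_of_cols_carrier(1) by (metis length_map)

lemma reg_mat_mult_outside_comm:
  assumes x: "\<And>t. x t \<in> carrier_vec (n_nodes G)" and pos: "0 < n_nodes G"
    and m: "m < n_nodes G * (T - max_lag G)"
    and out: "\<And>\<rho>. \<rho> \<in> set regs \<Longrightarrow> m mod n_nodes G \<notin> comm G (reg_comm \<rho>)"
    and v: "v \<in> carrier_vec (length regs)"
  shows "(reg_mat G T x regs *\<^sub>v v) $ m = 0"
proof -
  have "reg_mat G T x regs $$ (m, j) = 0" if "j < length regs" for j
    using m pos out[of "regs ! j"] that reg_value_outside_comm[OF x, of "m mod n_nodes G"]
    by (simp add: reg_mat_def mat_of_cols_def stack_def)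
  then have "row (reg_mat G T x regs) m = 0\<^sub>v (length regs)"
    using m reg_mat_carrier[of G T x regs] by (intro eq_vecI) auto
  then show ?thesis
    using m v reg_mat_carrier[of G T x regs] by (subst index_mult_mat_vec) auto
qed

text \<open>Concatenated labels give matrices side by side. This lets an induction over the
  communities split off one block at a time.\<close>

lemma reg_mat_append_mult:
  assumes v: "v \<in> carrier_vec (length as)" and w: "w \<in> carrier_vec (length bs)"
  shows "reg_mat G T x (as @ bs) *\<^sub>v (v @\<^sub>v w) = reg_mat G T x as *\<^sub>v v + reg_mat G T x bs *\<^sub>v w"
proof (rule eq_vecI)
  let ?N = "n_nodes G * (T - max_lag G)"
  fix m assume "m < dim_vec (reg_mat G T x as *\<^sub>v v + reg_mat G T x bs *\<^sub>v w)"
  then have m: "m < ?N" by (simp add: reg_mat_def mat_of_cols_def)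
  have "row (reg_mat G T x (as @ bs)) m = row (reg_mat G T x as) m @\<^sub>v row (reg_mat G T x bs) m"
    using m by (intro eq_vecI) (auto simp: reg_mat_def mat_of_cols_def nth_append)
  moreover have "row (reg_mat G T x regs) m \<in> carrier_vec (length regs)"
    "(reg_mat G T x regs *\<^sub>v z) $ m = row (reg_mat G T x regs) m \<bullet> z" for regs z
    using m reg_mat_carrier[of G T x regs] by auto
  ultimately show "(reg_mat G T x (as @ bs) *\<^sub>v (v @\<^sub>v w)) $ m =
      (reg_mat G T x as *\<^sub>v v + reg_mat G T x bs *\<^sub>v w) $ m"
    using m v w reg_mat_carrier[of G T x bs]
    by (simp add: scalar_prod_append[of _ "length as" _ "length bs"])
qed (use reg_mat_carrier[of G T x as] reg_mat_carrier[of G T x "as @ bs"]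
    reg_mat_carrier[of G T x bs] in simp)

lemma scalar_prod_self_add_orthogonal:
  fixes v w :: "real vec"
  assumes "v \<in> carrier_vec n" "w \<in> carrier_vec n" "\<And>i. i < n \<Longrightarrow> v $ i = 0 \<or> w $ i = 0"
  shows "(v + w) \<bullet> (v + w) = v \<bullet> v + w \<bullet> w"
proof -
  have "((v + w) $ i)\<^sup>2 = (v $ i)\<^sup>2 + (w $ i)\<^sup>2" if "i < n" for i
    using assms that by force
  then show ?thesis using assms by (simp add: scalar_prod_self sum.distrib)
qed

text \<open>The blocks of distinct communities live in disjoint sets of rows, so the squared norms of their
  contributions add up.\<close>

lemma reg_mat_comms_coercive:
  assumes x: "\<And>t. x t \<in> carrier_vec (n_nodes G)" and pos: "0 < n_nodes G"
    and "distinct cs" "disjoint_family_on (comm G) (set cs)"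
    and "\<And>c v. c \<in> set cs \<Longrightarrow> v \<in> carrier_vec (length (comm_regs G c)) \<Longrightarrow>
      \<kappa> * (v \<bullet> v) \<le> (comm_design G T x c *\<^sub>v v) \<bullet> (comm_design G T x c *\<^sub>v v)"
    and "v \<in> carrier_vec (length (concat (map (comm_regs G) cs)))"
  shows "\<kappa> * (v \<bullet> v) \<le>
    (reg_mat G T x (concat (map (comm_regs G) cs)) *\<^sub>v v) \<bullet>
    (reg_mat G T x (concat (map (comm_regs G) cs)) *\<^sub>v v)"
  using assms(3-)
proof (induction cs arbitrary: v)
  case Nil
  then show ?case by (simp add: scalar_prod_def sum_nonneg)
next
  case (Cons c cs)
  let ?N = "n_nodes G * (T - max_lag G)"
  let ?as = "comm_regs G c" and ?bs = "concat (map (comm_regs G) cs)"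
  define v1 v2 where "v1 = vec_first v (length ?as)" and "v2 = vec_last v (length ?bs)"
  have v1: "v1 \<in> carrier_vec (length ?as)" and v2: "v2 \<in> carrier_vec (length ?bs)"
    by (simp_all add: v1_def v2_def)
  have v: "v = v1 @\<^sub>v v2"
    using Cons.prems(4) by (simp add: v1_def v2_def del: length_concat)
  have disj: "disjoint_family_on (comm G) (set cs)"
    using Cons.prems(2) by (auto simp: disjoint_family_on_def)
  have "\<kappa> * (v \<bullet> v) = \<kappa> * (v1 \<bullet> v1) + \<kappa> * (v2 \<bullet> v2)"
    unfolding v using scalar_prod_append[OF v1 v2 v1 v2] by (simp add: algebra_simps)
  also have "\<dots> \<le> (reg_mat G T x ?as *\<^sub>v v1) \<bullet> (reg_mat G T x ?as *\<^sub>v v1) +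
      (reg_mat G T x ?bs *\<^sub>v v2) \<bullet> (reg_mat G T x ?bs *\<^sub>v v2)"
  proof (rule add_mono)
    show "\<kappa> * (v1 \<bullet> v1) \<le> (reg_mat G T x ?as *\<^sub>v v1) \<bullet> (reg_mat G T x ?as *\<^sub>v v1)"
      by (rule Cons.prems(3)[OF _ v1, unfolded comm_design_def]) simp
    show "\<kappa> * (v2 \<bullet> v2) \<le> (reg_mat G T x ?bs *\<^sub>v v2) \<bullet> (reg_mat G T x ?bs *\<^sub>v v2)"
    proof (rule Cons.IH[OF _ disj _ v2])
      show "distinct cs" using Cons.prems(1) by simp
    qed (rule Cons.prems(3), simp)
  qed
  also have "\<dots> = (reg_mat G T x ?as *\<^sub>v v1 + reg_mat G T x ?bs *\<^sub>v v2) \<bullet>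
      (reg_mat G T x ?as *\<^sub>v v1 + reg_mat G T x ?bs *\<^sub>v v2)"
  proof (rule scalar_prod_self_add_orthogonal[symmetric])
    fix m assume m: "m < ?N"
    \<comment> \<open>If the node of row \<open>m\<close> lies in community \<open>c\<close>,
      disjointness keeps it out of all remaining communities; otherwise it is outside
      \<open>c\<close>. One of the two blocks vanishes in this row either way.\<close>
    show "(reg_mat G T x ?as *\<^sub>v v1) $ m = 0 \<or> (reg_mat G T x ?bs *\<^sub>v v2) $ m = 0"
    proof (cases "m mod n_nodes G \<in> comm G c")
      case True
      have "m mod n_nodes G \<notin> comm G (reg_comm \<rho>)" if \<rho>: "\<rho> \<in> set ?bs" for \<rho>
      proof -
        obtain c' where c': "c' \<in> set cs" "\<rho> \<in> set (comm_regs G c')" using \<rho> by auto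
        then have "comm G c \<inter> comm G c' = {}"
          using Cons.prems(1,2) by (auto simp: disjoint_family_on_def)
        then show ?thesis using True reg_comm_comm_regs[OF c'(2)] by auto
      qed
      then show ?thesis by (intro disjI2 reg_mat_mult_outside_comm[where x = x, OF x pos m _ v2])
    next
      case False
      then show ?thesis
        by (intro disjI1 reg_mat_mult_outside_comm[where x = x, OF x pos m _ v1])
          (auto dest: reg_comm_comm_regs)
    qed
  qed (rule mult_mat_vec_carrier[OF reg_mat_carrier v1] mult_mat_vec_carrier[OF reg_mat_carrier v2])+
  also have "\<dots> = (reg_mat G T x (?as @ ?bs) *\<^sub>v v) \<bullet> (reg_mat G T x (?as @ ?bs) *\<^sub>v v)"
    unfolding v reg_mat_append_mult[OF v1 v2] ..
  finally show ?case by simp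
qed

section \<open>Sub-Gaussian tail bounds\<close>

text \<open>This carries independence from pairs of time and node to row numbers of the stacked
  noise. Injectivity makes the products over \<open>K\<close> and over its image agree.\<close>

lemma (in prob_space) indep_vars_reindex:
  assumes inj: "inj_on f J" and indep: "indep_vars M' X (f ` J)"
  shows "indep_vars (\<lambda>j. M' (f j)) (\<lambda>j. X (f j)) J"
  unfolding indep_vars_def2
proof (intro conjI ballI)
  show "random_variable (M' (f j)) (X (f j))" if "j \<in> J" for j
    using indep that by (auto simp: indep_vars_def2)
  let ?F = "\<lambda>i. {X i -` A \<inter> space M |A. A \<in> sets (M' i)}"
  have F: "indep_sets ?F (f ` J)" using indep by (simp add: indep_vars_def2)
  show "indep_sets (\<lambda>j. ?F (f j)) J"
  proof (rule indep_setsI)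
    show "?F (f j) \<subseteq> events" if "j \<in> J" for j
      using F that by (simp add: indep_sets_def)
    fix A K assume K: "K \<noteq> {}" "K \<subseteq> J" "finite K" and A: "\<forall>j\<in>K. A j \<in> ?F (f j)"
    have injK: "inj_on f K" using inj K(2) by (rule inj_on_subset)
    \<comment> \<open>The events chosen for the indices in \<open>K\<close> are moved to the image
      along the inverse of \<open>f\<close>.\<close>
    define B where "B i = A (inv_into K f i)" for i
    have B: "B (f j) = A j" if "j \<in> K" for j
      using that injK by (simp add: B_def)
    have "prob (\<Inter>i\<in>f ` K. B i) = (\<Prod>i\<in>f ` K. prob (B i))"
      using K A B by (intro indep_setsD[OF F]) auto
    then show "prob (\<Inter>j\<in>K. A j) = (\<Prod>j\<in>K. prob (A j))"
      using B by (simp add: prod.reindex[OF injK] cong: prod.cong INF_cong)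
  qed
qed

section \<open>Chernoff and union bounds\<close>

context prob_space
begin

context
  fixes Y :: "'i \<Rightarrow> 'a \<Rightarrow> real" and I :: "'i set" and \<nu> :: real
  assumes fin: "finite I" and indep: "indep_vars (\<lambda>_. borel) Y I"
    and int: "\<And>i z. i \<in> I \<Longrightarrow> integrable M (\<lambda>\<omega>. exp (z * Y i \<omega>))"
    and mgf: "\<And>i z. i \<in> I \<Longrightarrow> expectation (\<lambda>\<omega>. exp (z * Y i \<omega>)) \<le> exp (z\<^sup>2 * \<nu> / 2)"
begin

text \<open>Independence factorises the moment generating function. The factor at \<open>i\<close>
  is taken at \<open>z * a i\<close>, so the variance proxies \<open>\<nu> * (a i)\<^sup>2\<close>
  add up.\<close>

lemma mgf_weighted_sum:
  shows "integrable M (\<lambda>\<omega>. exp (z * (\<Sum>i\<in>I. a i * Y i \<omega>)))"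
    and "expectation (\<lambda>\<omega>. exp (z * (\<Sum>i\<in>I. a i * Y i \<omega>))) \<le> exp (z\<^sup>2 * (\<nu> * (\<Sum>i\<in>I. (a i)\<^sup>2)) / 2)"
proof -
  have eq: "exp (z * (\<Sum>i\<in>I. a i * Y i \<omega>)) = (\<Prod>i\<in>I. exp (z * a i * Y i \<omega>))" for \<omega>
    by (simp add: exp_sum[OF fin, symmetric] sum_distrib_left mult.assoc)
  have ind: "indep_vars (\<lambda>_. borel) (\<lambda>i \<omega>. exp (z * a i * Y i \<omega>)) I"
    using indep_vars_compose2[OF indep, of "\<lambda>i y. exp (z * a i * y)" "\<lambda>_. borel"] by simp
  show "integrable M (\<lambda>\<omega>. exp (z * (\<Sum>i\<in>I. a i * Y i \<omega>)))"
    unfolding eq by (rule indep_vars_integrable[OF fin ind int])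
  have "expectation (\<lambda>\<omega>. exp (z * (\<Sum>i\<in>I. a i * Y i \<omega>))) =
      (\<Prod>i\<in>I. expectation (\<lambda>\<omega>. exp (z * a i * Y i \<omega>)))"
    unfolding eq by (rule indep_vars_lebesgue_integral[OF fin ind int])
  also have "\<dots> \<le> (\<Prod>i\<in>I. exp ((z * a i)\<^sup>2 * \<nu> / 2))"
    using mgf by (intro prod_mono conjI integral_nonneg) auto
  also have "\<dots> = exp (z\<^sup>2 * (\<nu> * (\<Sum>i\<in>I. (a i)\<^sup>2)) / 2)"
    by (simp add: exp_sum[OF fin, symmetric] sum_distrib_left sum_divide_distrib[symmetric]
        power_mult_distrib mult_ac)
  finally show "expectation (\<lambda>\<omega>. exp (z * (\<Sum>i\<in>I. a i * Y i \<omega>)))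
      \<le> exp (z\<^sup>2 * (\<nu> * (\<Sum>i\<in>I. (a i)\<^sup>2)) / 2)" .
qed

text \<open>A Chernoff bound. Allowing any positive \<open>V\<close> above the exact proxy covers
  zero weights and lets one bound serve all columns of the design.\<close>

lemma weighted_sum_upper_tail:
  assumes V: "\<nu> * (\<Sum>i\<in>I. (a i)\<^sup>2) \<le> V" "V > 0" and y: "y > 0"
  shows "prob {\<omega> \<in> space M. y \<le> (\<Sum>i\<in>I. a i * Y i \<omega>)} \<le> exp (- y\<^sup>2 / (2 * V))"
proof -
  \<comment> \<open>The choice \<open>z = y / V\<close> minimises the exponent
    \<open>- z y + z^2 V / 2\<close>.\<close>
  let ?S = "\<lambda>\<omega>. \<Sum>i\<in>I. a i * Y i \<omega>" and ?z = "y / V"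
  have "prob {\<omega> \<in> space M. y \<le> ?S \<omega>} \<le> exp (- ?z * y) * (\<integral>\<omega>\<in>space M. exp (?z * ?S \<omega>) \<partial>M)"
    using V y mgf_weighted_sum(1)[of ?z a]
    by (intro Chernoff_ineq_ge)
      (auto simp: set_integrable_def intro!: integrable_mult_indicator[where 'b = real, simplified])
  also have "(\<integral>\<omega>\<in>space M. exp (?z * ?S \<omega>) \<partial>M) = expectation (\<lambda>\<omega>. exp (?z * ?S \<omega>))"
    by (rule set_integral_space[OF mgf_weighted_sum(1)])
  also have "\<dots> \<le> exp (?z\<^sup>2 * V / 2)"
    using V by (intro order_trans[OF mgf_weighted_sum(2)]) (simp add: divide_right_mono mult_left_mono)
  also have "exp (- ?z * y) * exp (?z\<^sup>2 * V / 2) = exp (- y\<^sup>2 / (2 * V))"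
    using V(2) unfolding exp_add[symmetric] by (simp add: field_simps power2_eq_square)
  finally show ?thesis by simp
qed

text \<open>The lower tail is the upper tail for the weights \<open>- a i\<close>, which have the
  same squares.\<close>

lemma weighted_sum_tail:
  assumes V: "\<nu> * (\<Sum>i\<in>I. (a i)\<^sup>2) \<le> V" "V > 0" and y: "y > 0"
  shows "prob {\<omega> \<in> space M. y \<le> \<bar>\<Sum>i\<in>I. a i * Y i \<omega>\<bar>} \<le> 2 * exp (- y\<^sup>2 / (2 * V))"
proof -
  have meas [measurable]: "Y i \<in> borel_measurable M" if "i \<in> I" for i
    using indep that by (simp add: indep_vars_def2)
  let ?E = "\<lambda>b. {\<omega> \<in> space M. y \<le> (\<Sum>i\<in>I. b i * Y i \<omega>)}"
  have "prob {\<omega> \<in> space M. y \<le> \<bar>\<Sum>i\<in>I. a i * Y i \<omega>\<bar>} \<le> prob (?E a \<union> ?E (\<lambda>i. - a i))"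
    by (intro finite_measure_mono) (auto simp: sum_negf)
  also have "\<dots> \<le> prob (?E a) + prob (?E (\<lambda>i. - a i))"
    by (intro measure_Un_le) auto
  also have "\<dots> \<le> exp (- y\<^sup>2 / (2 * V)) + exp (- y\<^sup>2 / (2 * V))"
    using assms by (intro add_mono weighted_sum_upper_tail) auto
  finally show ?thesis by simp
qed

end

text \<open>Entry \<open>j\<close> is a noise sum weighted by column \<open>j\<close>, whose sum of
  squares is at most \<open>L\<^sup>2\<close>; a union bound over the \<open>q\<close> columns gives
  the factor \<open>q\<close>.\<close>

lemma linf_norm_transpose_mult_tail:
  assumes R: "R \<in> carrier_mat N q" and q: "0 < q"
    and U: "\<And>\<omega>. \<omega> \<in> space M \<Longrightarrow> U \<omega> \<in> carrier_vec N"
    and indep: "indep_vars (\<lambda>_. borel) (\<lambda>m \<omega>. U \<omega> $ m) {..<N}"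
    and int: "\<And>m z. m < N \<Longrightarrow> integrable M (\<lambda>\<omega>. exp (z * U \<omega> $ m))"
    and mgf: "\<And>m z. m < N \<Longrightarrow> expectation (\<lambda>\<omega>. exp (z * U \<omega> $ m)) \<le> exp (z\<^sup>2 * \<nu> / 2)"
    and \<nu>: "\<nu> > 0" and L: "L > 0" "\<And>j. j < q \<Longrightarrow> l2_norm (col R j) \<le> L" and y: "y > 0"
  shows "1 - 2 * real q * exp (- y\<^sup>2 / (2 * (\<nu> * L\<^sup>2)))
    \<le> prob {\<omega> \<in> space M. linf_norm (transpose_mat R *\<^sub>v U \<omega>) \<le> y}"
proof -
  have meas [measurable]: "(\<lambda>\<omega>. U \<omega> $ m) \<in> borel_measurable M" if "m < N" for m
    using indep that by (simp add: indep_vars_def2)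
  let ?S = "\<lambda>j \<omega>. \<Sum>m<N. R $$ (m, j) * U \<omega> $ m"
  let ?E = "\<lambda>j. {\<omega> \<in> space M. y \<le> \<bar>?S j \<omega>\<bar>}"
  have S: "(transpose_mat R *\<^sub>v U \<omega>) $ j = ?S j \<omega>" if "\<omega> \<in> space M" "j < q" for \<omega> j
    using R U[OF that(1)] that(2) by (simp add: scalar_prod_def atLeast0LessThan)
  \<comment> \<open>Since \<open>q\<close> is positive, the \<open>Max\<close> is over a nonempty
    set and is at most \<open>y\<close> exactly when all entries are.\<close>
  have linf: "linf_norm (transpose_mat R *\<^sub>v U \<omega>) \<le> y \<longleftrightarrow> (\<forall>j<q. \<bar>?S j \<omega>\<bar> \<le> y)" if "\<omega> \<in> space M" for \<omega>
    unfolding linf_norm_def using R q S[OF that] by (subst Max_le_iff) auto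
  have set_eq: "{\<omega> \<in> space M. linf_norm (transpose_mat R *\<^sub>v U \<omega>) \<le> y} =
      {\<omega> \<in> space M. \<forall>j\<in>{..<q}. \<bar>?S j \<omega>\<bar> \<le> y}"
    using linf by auto
  have ev: "{\<omega> \<in> space M. \<forall>j\<in>{..<q}. \<bar>?S j \<omega>\<bar> \<le> y} \<in> events" by measurable
  have "1 - prob {\<omega> \<in> space M. \<forall>j\<in>{..<q}. \<bar>?S j \<omega>\<bar> \<le> y} =
      prob (space M - {\<omega> \<in> space M. \<forall>j\<in>{..<q}. \<bar>?S j \<omega>\<bar> \<le> y})"
    using prob_compl[OF ev] by simp
  also have "\<dots> \<le> prob (\<Union>j\<in>{..<q}. ?E j)"
    by (intro finite_measure_mono) (auto simp: not_le intro: less_imp_le)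
  also have "\<dots> \<le> (\<Sum>j<q. prob (?E j))"
    by (intro finite_measure_subadditive_finite) auto
  also have "\<dots> \<le> (\<Sum>j<q. 2 * exp (- y\<^sup>2 / (2 * (\<nu> * L\<^sup>2))))"
  proof (intro sum_mono weighted_sum_tail[OF _ indep])
    fix j assume j: "j \<in> {..<q}"
    have "(\<Sum>m<N. (R $$ (m, j))\<^sup>2) = (l2_norm (col R j))\<^sup>2"
      using R j by (simp add: l2_norm_sq scalar_prod_self)
    also have "\<dots> \<le> L\<^sup>2" using L j by (intro power_mono) (auto simp: l2_norm_nonneg)
    finally show "\<nu> * (\<Sum>m<N. (R $$ (m, j))\<^sup>2) \<le> \<nu> * L\<^sup>2" using \<nu> by simp
  qed (use \<nu> L(1) in \<open>simp_all add: int mgf y\<close>)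
  finally show ?thesis unfolding set_eq by simp
qed

end

text \<open>Monotonicity of the measure will require the set where the error bound holds to be an
  event. For fixed \<open>R\<close> the norm is an explicit function of the noise
  coordinates.\<close>

lemma measurable_l2_norm_ols:
  assumes U: "\<And>\<omega>. \<omega> \<in> space M \<Longrightarrow> U \<omega> \<in> carrier_vec (dim_row R)"
    and meas: "\<And>m. m < dim_row R \<Longrightarrow> (\<lambda>\<omega>. U \<omega> $ m) \<in> borel_measurable M"
  shows "(\<lambda>\<omega>. l2_norm (ols R (U \<omega>))) \<in> borel_measurable M"
proof -
  let ?H = "the (mat_inverse (transpose_mat R * R)) * transpose_mat R"
  have "l2_norm (ols R (U \<omega>)) = sqrt (\<Sum>i<dim_row ?H. (\<Sum>m<dim_row R. ?H $$ (i, m) * U \<omega> $ m)\<^sup>2)"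
    if "\<omega> \<in> space M" for \<omega>
    using U[OF that]
    by (simp add: l2_norm_def ols_def scalar_prod_self) (simp add: scalar_prod_def atLeast0LessThan)
  moreover have "(\<lambda>\<omega>. sqrt (\<Sum>i<dim_row ?H. (\<Sum>m<dim_row R. ?H $$ (i, m) * U \<omega> $ m)\<^sup>2))
      \<in> borel_measurable M"
    using meas by measurable
  ultimately show ?thesis by (simp cong: measurable_cong)
qed

section \<open>The error bounds\<close>

lemma wf_gnar_comm:
  assumes "wf_gnar G"
  shows "0 < n_nodes G" "0 < n_comms G" "disjoint_family_on (comm G) {1..n_comms G}"
    and "c \<in> {1..n_comms G} \<Longrightarrow> 0 < card (comm G c)" "c \<in> {1..n_comms G} \<Longrightarrow> 1 \<le> lag G c"
proof -
  show d: "0 < n_nodes G" and "disjoint_family_on (comm G) {1..n_comms G}"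
    using assms by (auto simp: wf_gnar_def)
  \<comment> \<open>Covering a nonempty finite node set yields at least one community and makes
    every community finite, so cardinalities are positive.\<close>
  have un: "(\<Union>c\<in>{1..n_comms G}. comm G c) = {..<n_nodes G}"
    using assms unfolding wf_gnar_def by blast
  then show "0 < n_comms G" using d by (cases "n_comms G = 0") auto
  show "1 \<le> lag G c" if "c \<in> {1..n_comms G}" using assms that unfolding wf_gnar_def by blast
  show "0 < card (comm G c)" if "c \<in> {1..n_comms G}"
  proof -
    have "comm G c \<noteq> {}" using assms that unfolding wf_gnar_def by blast
    moreover have "finite (comm G c)" using un that by (metis UN_upper finite_lessThan finite_subset)
    ultimately show ?thesis by (simp add: card_gt_0_iff)
  qed
qed

lemma length_all_regs:
  assumes "wf_gnar G"
  shows "length (all_regs G) = (\<Sum>c=1..n_comms G. n_params G c)"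
proof -
  have "length (all_regs G) = (\<Sum>c\<leftarrow>[1..<Suc (n_comms G)]. length (comm_regs G c))"
    by (simp add: all_regs_def length_concat comp_def del: upt_Suc)
  also have "\<dots> = (\<Sum>c=1..n_comms G. length (comm_regs G c))"
    by (simp add: interv_sum_list_conv_sum_set_nat atLeastLessThanSuc_atLeastAtMost del: upt_Suc)
  also have "\<dots> = (\<Sum>c=1..n_comms G. n_params G c)"
    using length_comm_regs[OF assms] by (intro sum.cong) auto
  finally show ?thesis .
qed

lemma length_all_regs_le: "wf_gnar G \<Longrightarrow> length (all_regs G) \<le> n_comms G * max_n_params G"
  using sum_bounded_above[of "{1..n_comms G}" "n_params G" "max_n_params G"]
  by (simp add: length_all_regs max_n_params_def)

text \<open>Every lag order is at least 1, so community 1 already contributes a column. This makes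
  supremum norms well defined and \<open>ln q\<close> nonnegative.\<close>

lemma length_all_regs_pos:
  assumes G: "wf_gnar G"
  shows "0 < length (all_regs G)"
proof -
  have "1 \<in> {1..n_comms G}" using wf_gnar_comm(2)[OF G] by simp
  moreover from this have "0 < n_params G 1"
    using wf_gnar_comm(5)[OF G] by (fastforce simp: n_params_def)
  ultimately show ?thesis unfolding length_all_regs[OF G] by (meson finite_atLeastAtMost sum_pos2 zero_le)
qed

text \<open>Each block is bounded below through its Gram matrix. Sharing one constant
  \<open>\<kappa>\<close> lets the contributions of the blocks be added.\<close>

lemma design_coercive:
  assumes G: "wf_gnar G" and x: "\<And>t. x t \<in> carrier_vec (n_nodes G)"
    and lam: "\<And>c. c \<in> {1..n_comms G} \<Longrightarrow>
      \<kappa> \<le> lambda_min (transpose_mat (comm_design G T x c) * comm_design G T x c)"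
    and v: "v \<in> carrier_vec (length (all_regs G))"
  shows "\<kappa> * (v \<bullet> v) \<le> (design G T x *\<^sub>v v) \<bullet> (design G T x *\<^sub>v v)"
  unfolding design_def all_regs_def
proof (rule reg_mat_comms_coercive[OF x])
  show "0 < n_nodes G" by (rule wf_gnar_comm[OF G])
  show "disjoint_family_on (comm G) (set [1..<Suc (n_comms G)])"
    using wf_gnar_comm(3)[OF G] by (simp add: atLeastLessThanSuc_atLeastAtMost del: upt_Suc)
  show "v \<in> carrier_vec (length (concat (map (comm_regs G) [1..<Suc (n_comms G)])))"
    using v by (simp add: all_regs_def del: upt_Suc)
  fix c and w :: "real vec" assume c: "c \<in> set [1..<Suc (n_comms G)]" and w: "w \<in> carrier_vec (length (comm_regs G c))"
  have "\<kappa> * (w \<bullet> w) \<le> lambda_min (transpose_mat (comm_design G T x c) * comm_design G T x c) * (w \<bullet> w)"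
    using lam[of c] c by (intro mult_right_mono scalar_prod_self_nonneg) auto
  also have "\<dots> \<le> (comm_design G T x c *\<^sub>v w) \<bullet> (comm_design G T x c *\<^sub>v w)"
    using reg_mat_carrier w unfolding comm_design_def by (rule lambda_min_gram)
  finally show "\<kappa> * (w \<bullet> w) \<le> (comm_design G T x c *\<^sub>v w) \<bullet> (comm_design G T x c *\<^sub>v w)" .
qed simp

lemma stack_carrier: "stack G T x \<in> carrier_vec (n_nodes G * (T - max_lag G))"
  by (simp add: stack_def)

text \<open>The maximum of the \<open>sigma2 i\<close> is a variance proxy common to all nodes, and
  therefore to all rows of the stacked noise.\<close>

lemma subgaussian_noise_stack:
  assumes M: "prob_space M" and d: "0 < n_nodes G"
    and u: "subgaussian_noise M (n_nodes G) {max_lag G + 1..T} sigma2 u"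
  defines "\<nu> \<equiv> Max (sigma2 ` {..<n_nodes G})" and "N \<equiv> n_nodes G * (T - max_lag G)"
  shows "\<nu> > 0"
    and "prob_space.indep_vars M (\<lambda>_. borel) (\<lambda>m \<omega>. stack G T (\<lambda>t. u t \<omega>) $ m) {..<N}"
    and "m < N \<Longrightarrow> integrable M (\<lambda>\<omega>. exp (z * stack G T (\<lambda>t. u t \<omega>) $ m))"
    and "m < N \<Longrightarrow> (\<integral>\<omega>. exp (z * stack G T (\<lambda>t. u t \<omega>) $ m) \<partial>M) \<le> exp (z\<^sup>2 * \<nu> / 2)"
proof -
  interpret prob_space M by (rule M)
  let ?d = "n_nodes G" and ?ts = "{max_lag G + 1..T}"
  \<comment> \<open>Time and node of row \<open>m\<close>; quotient and remainder determine
    \<open>m\<close>, so \<open>f\<close> is injective.\<close>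
  define f where "f m = (max_lag G + 1 + m div ?d, m mod ?d)" for m
  have f: "f m \<in> ?ts \<times> {..<?d}" if "m < N" for m
  proof -
    have "m div ?d < T - max_lag G" using that by (simp add: N_def less_mult_imp_div_less mult.commute)
    then show ?thesis using d by (simp add: f_def)
  qed
  have inj: "inj_on f {..<N}"
    by (rule inj_onI) (metis f_def add_left_cancel div_mult_mod_eq prod.inject)
  have st: "stack G T (\<lambda>t. u t \<omega>) $ m = u (int (fst (f m))) \<omega> $ snd (f m)" if "m < N" for m \<omega>
    using that by (simp add: stack_def f_def N_def)
  have \<nu>: "sigma2 i \<le> \<nu>" if "i < ?d" for i
    unfolding \<nu>_def using that by (intro Max_ge) auto
  show "\<nu> > 0" using u d \<nu>[OF d] by (auto simp: subgaussian_noise_def intro: less_le_trans)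
  have "indep_vars (\<lambda>_. borel) (\<lambda>(t, i) \<omega>. u (int t) \<omega> $ i) (f ` {..<N})"
  proof (rule indep_vars_subset)
    show "indep_vars (\<lambda>_. borel) (\<lambda>(t, i) \<omega>. u (int t) \<omega> $ i) (?ts \<times> {..<?d})"
      using u unfolding subgaussian_noise_def by blast
    show "f ` {..<N} \<subseteq> ?ts \<times> {..<?d}" using f by blast
  qed
  from indep_vars_reindex[OF inj this]
  show "indep_vars (\<lambda>_. borel) (\<lambda>m \<omega>. stack G T (\<lambda>t. u t \<omega>) $ m) {..<N}"
    by (rule indep_vars_cong[THEN iffD1, rotated -1]) (auto simp: st split_beta)
  assume m: "m < N"
  then have fm: "fst (f m) \<in> ?ts" "snd (f m) < ?d" using f[OF m] by auto
  show "integrable M (\<lambda>\<omega>. exp (z * stack G T (\<lambda>t. u t \<omega>) $ m))"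
    unfolding st[OF m] using u fm by (simp add: subgaussian_noise_def)
  have "(\<integral>\<omega>. exp (z * stack G T (\<lambda>t. u t \<omega>) $ m) \<partial>M) \<le> exp (z\<^sup>2 * sigma2 (snd (f m)) / 2)"
    unfolding st[OF m] using u fm unfolding subgaussian_noise_def by blast
  also have "\<dots> \<le> exp (z\<^sup>2 * \<nu> / 2)"
    using \<nu>[OF fm(2)] by (simp add: divide_right_mono mult_left_mono)
  finally show "(\<integral>\<omega>. exp (z * stack G T (\<lambda>t. u t \<omega>) $ m) \<partial>M) \<le> exp (z\<^sup>2 * \<nu> / 2)" .
qed

lemma powr_minus_half:
  assumes "x > 0"
  shows "x powr (-1/2) = 1 / sqrt x"
proof -
  have "x powr - (1/2) = 1 / sqrt x"
    using assms by (simp only: powr_minus_divide powr_half_sqrt[OF less_imp_le])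
  then show ?thesis by simp
qed

text \<open>The threshold is chosen so that its Gaussian exponent
  \<open>n (sqrt (ln q) + \<delta> sqrt s)\<^sup>2\<close> absorbs the factor \<open>q\<close> of the union bound over the columns.\<close>

lemma union_bound_threshold:
  fixes q \<sigma> \<Gamma> \<delta> s n :: real
  assumes q: "q \<ge> 1" and \<sigma>: "\<sigma> > 0" and \<Gamma>: "\<Gamma> > 0" and \<delta>: "\<delta> > 0" and s: "s > 0" and n: "n \<ge> 1"
  defines "y \<equiv> \<sigma> * \<Gamma> * sqrt 2 * (sqrt (ln q) + \<delta> * sqrt s)"
  shows "2 * q * exp (- y\<^sup>2 / (2 * (\<sigma>\<^sup>2 * (n powr (-1/2) * \<Gamma>)\<^sup>2))) \<le> 2 * exp (- (\<delta>\<^sup>2 * s))"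
proof -
  define a where "a = (sqrt (ln q) + \<delta> * sqrt s)\<^sup>2"
  have y2: "y\<^sup>2 = 2 * (\<sigma>\<^sup>2 * \<Gamma>\<^sup>2) * a"
    by (simp add: y_def a_def power_mult_distrib)
  \<comment> \<open>Squaring \<open>n powr (-1/2)\<close> is what puts the factor \<open>n\<close>
    into the exponent.\<close>
  have L2: "(n powr (-1/2) * \<Gamma>)\<^sup>2 = \<Gamma>\<^sup>2 / n"
    using n powr_minus_half[of n] by (simp only: power_mult_distrib power_divide) simp
  have "y\<^sup>2 / (2 * (\<sigma>\<^sup>2 * (n powr (-1/2) * \<Gamma>)\<^sup>2)) = n * a"
    unfolding y2 L2 using \<sigma> \<Gamma> n by simp
  \<comment> \<open>The cross term of the square is nonnegative and is dropped.\<close>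
  moreover have "ln q + \<delta>\<^sup>2 * s \<le> a"
    using q \<delta> s by (simp add: a_def power2_sum power_mult_distrib)
  moreover have "a \<le> n * a"
    using n mult_right_mono[of 1 n a] by (simp add: a_def)
  ultimately have "exp (- y\<^sup>2 / (2 * (\<sigma>\<^sup>2 * (n powr (-1/2) * \<Gamma>)\<^sup>2))) \<le> exp (- ln q - \<delta>\<^sup>2 * s)"
    by simp
  then have "2 * q * exp (- y\<^sup>2 / (2 * (\<sigma>\<^sup>2 * (n powr (-1/2) * \<Gamma>)\<^sup>2))) \<le> 2 * q * exp (- ln q - \<delta>\<^sup>2 * s)"
    using q by (intro mult_left_mono) auto
  also have "\<dots> = 2 * exp (- (\<delta>\<^sup>2 * s))"
    using q by (simp add: exp_diff exp_minus divide_inverse)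
  finally show ?thesis .
qed

text \<open>Fixed design: \<open>R\<close> comes from the single outcome
  \<open>\<omega>\<^sub>0\<close>, while the noise in \<open>U\<close> is evaluated at a varying
  outcome.\<close>

theorem theorem2:
  fixes G :: gnar and M :: "'w measure"
    and X u :: "int \<Rightarrow> 'w \<Rightarrow> real vec"
    and \<alpha> :: "nat \<Rightarrow> nat \<Rightarrow> real"
    and \<beta> :: "nat \<Rightarrow> nat \<Rightarrow> nat \<Rightarrow> real"
    and \<gamma> :: "nat \<Rightarrow> nat \<Rightarrow> nat \<Rightarrow> nat \<Rightarrow> real"
    and T :: nat and \<omega>\<^sub>0 :: 'w
    and R :: "real mat" and \<theta>\<^sub>0 :: "real vec"
    and U y \<theta>hat :: "'w \<Rightarrow> real vec"
    and \<tau>c :: "nat \<Rightarrow> real" and \<Gamma> \<tau> n :: real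
  assumes "prob_space M"
    and "wf_gnar G"
    and "gnar_process M G \<alpha> \<beta> \<gamma> X u"
    and "stationary M (n_nodes G) X"
    and "max_lag G < T"
    and "\<omega>\<^sub>0 \<in> space M"
    and "R = design G T (\<lambda>t. X t \<omega>\<^sub>0)"
    and "\<theta>\<^sub>0 = param_vec G \<alpha> \<beta> \<gamma>"
    and "\<And>\<omega>. U \<omega> = stack G T (\<lambda>t. u t \<omega>)"
    and "\<And>\<omega>. y \<omega> = R *\<^sub>v \<theta>\<^sub>0 + U \<omega>"
    and "\<And>\<omega>. \<theta>hat \<omega> = ols R (y \<omega>)"
    and A1: "\<And>c. c \<in> {1..n_comms G} \<Longrightarrow> \<tau>c c > 0 \<and>
           lambda_min (transpose_mat (comm_design G T (\<lambda>t. X t \<omega>\<^sub>0) c) *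
                       comm_design G T (\<lambda>t. X t \<omega>\<^sub>0) c)
             \<ge> sqrt (\<tau>c c * real (card (comm G c)) * (real T - real (lag G c)))"
    and "n = Min ((\<lambda>c. real (card (comm G c)) * (real T - real (lag G c))) ` {1..n_comms G})"
    and A2: "\<Gamma> > 0" "Max ((\<lambda>j. l2_norm (col R j)) ` {..<dim_col R}) \<le> n powr (-1/2) * \<Gamma>"
    and "\<tau> = Min (\<tau>c ` {1..n_comms G})"
  shows "(\<forall>\<omega>\<in>space M.
            l2_norm (\<theta>hat \<omega> - \<theta>\<^sub>0)
              \<le> 2 * (\<tau> * real (min_comm_size G) * (real T - real (max_lag G))) powr (-1/2) * sqrt (real (n_comms G) * real (max_n_params G))
                  * linf_norm (transpose_mat R *\<^sub>v U \<omega>)) \<and>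
         (\<forall>sigma2 \<sigma>\<^sub>u.
            subgaussian_noise M (n_nodes G) {max_lag G + 1..T} sigma2 u \<longrightarrow>
            \<sigma>\<^sub>u = sqrt (Max (sigma2 ` {..<n_nodes G})) \<longrightarrow>
            (\<forall>\<delta>>0.
               measure M {\<omega> \<in> space M.
                   l2_norm (\<theta>hat \<omega> - \<theta>\<^sub>0)
                     \<le> 2 * sqrt (real (n_comms G) * real (max_n_params G)) * \<sigma>\<^sub>u * \<Gamma> * sqrt 2 *
                        (sqrt (ln (real (\<Sum>c=1..n_comms G. n_params G c))
                               / (\<tau> * real (min_comm_size G) * (real T - real (max_lag G)))) + \<delta>)}
                 \<ge> 1 - 2 * exp (- (\<delta>\<^sup>2 * (\<tau> * real (min_comm_size G) * (real T - real (max_lag G)))))))"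
proof -
  interpret prob_space M by fact
  note G = \<open>wf_gnar G\<close>
  note pos = wf_gnar_comm[OF G]
  let ?x = "\<lambda>t. X t \<omega>\<^sub>0" and ?N = "n_nodes G * (T - max_lag G)" and ?q = "length (all_regs G)"
  let ?D = "sqrt (real (n_comms G) * real (max_n_params G))"
  define s where "s = \<tau> * real (min_comm_size G) * (real T - real (max_lag G))"
  have x: "?x t \<in> carrier_vec (n_nodes G)" for t
    using \<open>gnar_process M G \<alpha> \<beta> \<gamma> X u\<close> \<open>\<omega>\<^sub>0 \<in> space M\<close> by (simp add: gnar_process_def)
  have R: "R \<in> carrier_mat ?N ?q"
    using reg_mat_carrier by (simp add: \<open>R = _\<close> design_def)
  have \<theta>: "\<theta>\<^sub>0 \<in> carrier_vec ?q"
    by (simp add: \<open>\<theta>\<^sub>0 = _\<close> param_vec_def carrier_vecI)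
  have U: "U \<omega> \<in> carrier_vec ?N" for \<omega>
    by (simp add: \<open>\<And>\<omega>. U \<omega> = _\<close> stack_carrier)
  have C: "{1..n_comms G} \<noteq> {}" using pos(2) by simp
  have lag_le: "lag G c \<le> max_lag G" if "c \<in> {1..n_comms G}" for c
    unfolding max_lag_def using that by (intro Max_ge) auto
  have size_le: "min_comm_size G \<le> card (comm G c)" if "c \<in> {1..n_comms G}" for c
    unfolding min_comm_size_def using that by (intro Min_le) auto
  have size_pos: "0 < min_comm_size G"
    unfolding min_comm_size_def using C pos(4) by (subst Min_gr_iff) auto
  have \<tau>_le: "\<tau> \<le> \<tau>c c" if "c \<in> {1..n_comms G}" for c
    unfolding \<open>\<tau> = _\<close> using that by (intro Min_le) auto
  have \<tau>_pos: "0 < \<tau>"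
    unfolding \<open>\<tau> = _\<close> using C A1 by (subst Min_gr_iff) auto
  have s: "s > 0"
    using \<tau>_pos size_pos \<open>max_lag G < T\<close> by (simp add: s_def)
  \<comment> \<open>Each factor of \<open>s\<close> takes its least favourable value over the
    communities, so \<open>s\<close> is below every radicand in (A.1).\<close>
  have lam: "sqrt s \<le> lambda_min (transpose_mat (comm_design G T ?x c) * comm_design G T ?x c)"
    if c: "c \<in> {1..n_comms G}" for c
  proof -
    have "s \<le> \<tau>c c * real (card (comm G c)) * (real T - real (lag G c))"
      unfolding s_def using \<tau>_pos size_pos \<open>max_lag G < T\<close> \<tau>_le[OF c] size_le[OF c] lag_le[OF c]
      by (intro mult_mono) auto
    then show ?thesis using A1[OF c] by (meson order_trans real_sqrt_le_mono)
  qed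
  have coercive: "sqrt s * (v \<bullet> v) \<le> (R *\<^sub>v v) \<bullet> (R *\<^sub>v v)" if "v \<in> carrier_vec ?q" for v
    unfolding \<open>R = _\<close> by (rule design_coercive[where x = ?x, OF G x lam that])
  have s_half: "s powr (-1/2) = 1 / sqrt s"
    using s by (rule powr_minus_half)
  have err: "\<theta>hat \<omega> - \<theta>\<^sub>0 = ols R (U \<omega>)" for \<omega>
    using ols_error[OF R _ coercive \<theta> U] s by (simp add: \<open>\<And>\<omega>. \<theta>hat \<omega> = _\<close> \<open>\<And>\<omega>. y \<omega> = _\<close>)
  have q_pos: "0 < ?q" by (rule length_all_regs_pos[OF G])
  have bound: "l2_norm (\<theta>hat \<omega> - \<theta>\<^sub>0) \<le> 2 * s powr (-1/2) * ?D * linf_norm (transpose_mat R *\<^sub>v U \<omega>)" for \<omega>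
  proof -
    \<comment> \<open>There is at least one column, so entry 0 exists and shows that
      \<open>?l\<close> is nonnegative.\<close>
    let ?l = "linf_norm (transpose_mat R *\<^sub>v U \<omega>)"
    have dim: "dim_vec (transpose_mat R *\<^sub>v U \<omega>) = ?q" using R by simp
    have "\<bar>(transpose_mat R *\<^sub>v U \<omega>) $ 0\<bar> \<le> ?l"
      unfolding linf_norm_def dim using q_pos by (intro Max_ge) auto
    then have l: "0 \<le> ?l" by linarith
    have "sqrt s * l2_norm (ols R (U \<omega>)) \<le> l2_norm (transpose_mat R *\<^sub>v U \<omega>)"
      using s by (intro l2_norm_ols[OF R _ coercive U]) auto
    also have "\<dots> \<le> sqrt (real ?q) * ?l"
      using l2_norm_le_linf_norm[of "transpose_mat R *\<^sub>v U \<omega>"] unfolding dim .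
    also have "\<dots> \<le> ?D * ?l"
      using l length_all_regs_le[OF G] by (intro mult_right_mono) (simp_all flip: of_nat_mult)
    \<comment> \<open>The argument gives the constant 1; the factor 2 of the claim is slack.\<close>
    also have "\<dots> \<le> 2 * (?D * ?l)" using l by simp
    finally show ?thesis unfolding err s_half using s by (simp add: field_simps)
  qed
  have q_eq: "real (\<Sum>c=1..n_comms G. n_params G c) = real ?q" by (simp only: length_all_regs[OF G])
  have q1: "1 \<le> real ?q" using q_pos by linarith
  have tail: "1 - 2 * exp (- (\<delta>\<^sup>2 * s)) \<le> prob {\<omega> \<in> space M. l2_norm (\<theta>hat \<omega> - \<theta>\<^sub>0)
        \<le> 2 * ?D * \<sigma>\<^sub>u * \<Gamma> * sqrt 2 * (sqrt (ln (real ?q) / s) + \<delta>)}"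
    if sub: "subgaussian_noise M (n_nodes G) {max_lag G + 1..T} sigma2 u"
      and \<sigma>\<^sub>u: "\<sigma>\<^sub>u = sqrt (Max (sigma2 ` {..<n_nodes G}))" and \<delta>: "\<delta> > 0" for sigma2 \<sigma>\<^sub>u \<delta>
  proof -
    note noise = subgaussian_noise_stack[OF \<open>prob_space M\<close> pos(1) sub, folded \<open>\<And>\<omega>. U \<omega> = _\<close>]
    have \<sigma>: "\<sigma>\<^sub>u > 0" "\<sigma>\<^sub>u\<^sup>2 = Max (sigma2 ` {..<n_nodes G})"
      using noise(1) by (simp_all add: \<sigma>\<^sub>u)
    \<comment> \<open>Multiplying this threshold by \<open>2 * s powr (-1/2) * ?D\<close>, the
      factor in the deterministic bound, gives exactly the claimed error bound.\<close>
    let ?y = "\<sigma>\<^sub>u * \<Gamma> * sqrt 2 * (sqrt (ln (real ?q)) + \<delta> * sqrt s)"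
    let ?L = "n powr (-1/2) * \<Gamma>"
    \<comment> \<open>Communities are nonempty and every lag order is an integer below
      \<open>T\<close>, so both factors are at least 1.\<close>
    have n: "1 \<le> n"
    proof -
      have "1 * 1 \<le> real (card (comm G c)) * (real T - real (lag G c))" if "c \<in> {1..n_comms G}" for c
        using pos(4)[OF that] lag_le[OF that] \<open>max_lag G < T\<close> by (intro mult_mono) auto
      then show ?thesis unfolding \<open>n = _\<close> using C by (subst Min_ge_iff) auto
    qed
    have col: "l2_norm (col R j) \<le> ?L" if "j < ?q" for j
    proof (rule order_trans[OF _ A2(2)])
      show "l2_norm (col R j) \<le> Max ((\<lambda>j. l2_norm (col R j)) ` {..<dim_col R})"
        using R that by (intro Max_ge) auto
    qed
    have y: "?y > 0" using \<sigma>(1) A2(1) \<delta> s q1 by (simp add: add_nonneg_pos)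
    have "1 - 2 * exp (- (\<delta>\<^sup>2 * s)) \<le> 1 - 2 * real ?q * exp (- ?y\<^sup>2 / (2 * (\<sigma>\<^sub>u\<^sup>2 * ?L\<^sup>2)))"
      using union_bound_threshold[OF q1 \<sigma>(1) A2(1) \<delta> s n] by simp
    also have "\<dots> \<le> prob {\<omega> \<in> space M. linf_norm (transpose_mat R *\<^sub>v U \<omega>) \<le> ?y}"
      using n A2(1) \<sigma> noise(1)
      by (intro linf_norm_transpose_mult_tail[OF R q_pos U noise(2)] noise(3) col y)
        (auto intro: noise(4))
    also have "\<dots> \<le> prob {\<omega> \<in> space M. l2_norm (\<theta>hat \<omega> - \<theta>\<^sub>0)
        \<le> 2 * ?D * \<sigma>\<^sub>u * \<Gamma> * sqrt 2 * (sqrt (ln (real ?q) / s) + \<delta>)}"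
    proof (rule finite_measure_mono)
      have "l2_norm (\<theta>hat \<omega> - \<theta>\<^sub>0) \<le> 2 * ?D * \<sigma>\<^sub>u * \<Gamma> * sqrt 2 * (sqrt (ln (real ?q) / s) + \<delta>)"
        if "linf_norm (transpose_mat R *\<^sub>v U \<omega>) \<le> ?y" for \<omega>
      proof -
        have "l2_norm (\<theta>hat \<omega> - \<theta>\<^sub>0) \<le> 2 * s powr (-1/2) * ?D * ?y"
          using that by (intro order_trans[OF bound] mult_left_mono) auto
        also have "\<dots> = 2 * ?D * \<sigma>\<^sub>u * \<Gamma> * sqrt 2 * (sqrt (ln (real ?q) / s) + \<delta>)"
          unfolding s_half real_sqrt_divide using s by (simp add: field_simps)
        finally show ?thesis .
      qed
      then show "{\<omega> \<in> space M. linf_norm (transpose_mat R *\<^sub>v U \<omega>) \<le> ?y} \<subseteq>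
          {\<omega> \<in> space M. l2_norm (\<theta>hat \<omega> - \<theta>\<^sub>0)
            \<le> 2 * ?D * \<sigma>\<^sub>u * \<Gamma> * sqrt 2 * (sqrt (ln (real ?q) / s) + \<delta>)}"
        by blast
      have "(\<lambda>\<omega>. l2_norm (ols R (U \<omega>))) \<in> borel_measurable M"
        using R U noise(2) by (intro measurable_l2_norm_ols) (auto simp: indep_vars_def2)
      then show "{\<omega> \<in> space M. l2_norm (\<theta>hat \<omega> - \<theta>\<^sub>0)
            \<le> 2 * ?D * \<sigma>\<^sub>u * \<Gamma> * sqrt 2 * (sqrt (ln (real ?q) / s) + \<delta>)} \<in> events"
        unfolding err by measurable
    qed
    finally show ?thesis .
  qed
  show ?thesis
    unfolding q_eq s_def[symmetric] using bound tail by blast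
qed

end
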